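(* Let $T$ be an oriented real $n$-dimensional vector space with a Euclidean metric $g$ and $B\in\Lambda^2T^*$. Let $\Psi_L,\Psi_R\in\Delta_n$ be unit spinors, chiral if $n$ is even, and put $$\rho^{ev}=e^B\wedge\operatorname{Re}\big([\Psi_L\otimes\Psi_R]^{ev}\big),\qquad \rho^{od}=e^B\wedge\operatorname{Re}\big([\Psi_L\otimes\Psi_R]^{od}\big).$$ Then for $\rho=\rho^{ev}$ and for $\rho=\rho^{od}$ the inequality $\langle\rho,\tau_{L,F}\rangle\le\|\tau_{L,F}\|_{\mathcal G}$ holds for every isotropic pair $(L,F)$. Moreover, let $(L,F)$ be an isotropic pair with $k=\dim L$, and let $\rho=\rho^{ev}$ if $k$ is even and $\rho=\rho^{od}$ if $k$ is odd. Then $(L,F)$ meets the bound, i.e. $\langle\rho,\tau_{L,F}\rangle=\|\tau_{L,F}\|_{\mathcal G}$, if and only if (a) in case $n=2m$ and $\Psi_R\in\Delta_{n,\pm}$: $$\mathcal A(\Psi_L)=\pm(-1)^{m(m+1)/2+k}\,i^m\,\Big(\frac{e^{-B}\wedge\tau_{L,F}}{\|\tau_{L,F}\|_{\mathcal G}}\Big)\cdot\Psi_R;$$ (b) in case $n=2m+1$: $$\mathcal A(\Psi_L)=(-1)^{m(m+1)/2}\,i^{m+1}\,\Big(\frac{e^{-B}\wedge\tau_{L,F}}{\|\tau_{L,F}\|_{\mathcal G}}\Big)\cdot\Psi_R.$$ In particular, $\rho^{ev}$ and $\rho^{od}$ define generalised calibrations.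
   Context: Forms and pairing: $S_\pm=\Lambda^{ev,od}T^*$. For a $p$-form, $\widehat{\alpha}=(-1)^{p(p+1)/2}\alpha$, extended linearly. $\langle\rho,\tau\rangle\in\mathbb R$ is the coefficient of the Riemannian volume form $\varpi_g$ in the degree-$n$ part of $\rho\wedge\widehat\tau$. The norm of the generalised metric $(g,B)$ is $\|\tau\|_{\mathcal G}=|e^{-B}\wedge\tau|_g$, with $|\cdot|_g$ the norm on $\Lambda^*T^*$ induced by $g$ (for which the $e_K$, for $e_1,\dots,e_n$ orthonormal, are orthonormal). Isotropic pairs: an isotropic pair $(L,F)$ consists of an oriented subspace $L\subset T$ of dimension $k$ and $F\in\Lambda^2L^*$. Let $\varpi_L$ be the volume form of $L$ (pulled back to $T$ by orthogonal projection $p_L:T\to L$), and $\tau_{L,F}=e^{p_L^*F}\wedge\widehat{\star\varpi_L}$, with $\star$ the Hodge star of $(T,g)$. Calibrations: $\rho\in S_\pm$ is a generalised calibration for $(g,B)$ if $\langle\rho,\tau_{L,F}\rangle\le\|\tau_{L,F}\|_{\mathcal G}$ for every isotropic pair $(L,F)$ and there is at least one isotropic pair for which equality holds. Spinors: the Clifford algebra $\mathrm{Cliff}(T,g)$ has the convention $v\cdot v=-g(v,v)$; $\Lambda^*T^*$ is identified with it by the canonical vector space isomorphism ($e_{i_1}\wedge\dots\wedge e_{i_p}\leftrightarrow e_{i_1}\cdots e_{i_p}$ for an orthonormal basis), so forms act on spinors. $\Delta_n$ is the complex spin representation, of dimension $2^{[n/2]}$, where for $n=2m+1$ the Clifford module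 is chosen so that $\varpi_g\cdot\Psi=(-1)^{m(m+1)/2}i^{m+1}\Psi$; for $n=2m$, $\Delta_n=\Delta_{n,+}\oplus\Delta_{n,-}$ with $\varpi_g\cdot\Psi_\pm=\pm(-1)^{m(m+1)/2}i^m\Psi_\pm$, and chiral means lying in $\Delta_{n,+}$ or $\Delta_{n,-}$. $q$ is the Hermitian inner product on $\Delta_n$, conjugate-linear in the first argument, with $q(a\cdot\Psi,\Phi)=q(\Psi,\widehat a\cdot\Phi)$ for real Clifford elements $a$. $\mathcal A$ is the conjugate-linear endomorphism of $\Delta_n$ (charge conjugation) with $\mathcal A(X\cdot\Psi)=(-1)^{m+1}X\cdot\mathcal A(\Psi)$ for $X\in T$ and $\mathcal A^2=(-1)^{m(m+1)/2}\mathrm{Id}$, $n=2m$ or $2m+1$. Fierzing map: $[\Psi_L\otimes\Psi_R]=\sum_K q(\mathcal A(\Psi_L),e_K\cdot\Psi_R)\,e_K\in\Lambda^*T^*\otimes\mathbb C$, the sum over increasing multi-indices $K$ for an orthonormal basis; $[\cdot]^{ev},[\cdot]^{od}$ are the even and odd parts and $\operatorname{Re}$ is the real part of a complex form.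
   Formalization: The closing sentence fails for arbitrary spinors (for even n one of ρ^ev, ρ^od is 0, so equality never holds); instead ρ^ev (ρ^od) is shown to be a generalised calibration if and only if some isotropic pair with k even (odd) satisfies (a)/(b). *)

theory Defs
  imports "HOL-Analysis.Analysis"
begin

section \<open>Exterior forms\<close>

text \<open>
  The oriented Euclidean vector space \<open>T\<close> is a type of class \<^class>\<open>euclidean_space\<close> together with
  a positively oriented orthonormal basis \<open>es = [e_1, ..., e_n]\<close>. A mixed exterior form is a
  function on lists of vectors: its degree \<open>p\<close> part is its restriction to lists of length \<open>p\<close>,
  which is an alternating \<open>p\<close>-linear map.
\<close>

type_synonym 'a form = "'a list \<Rightarrow> real"

text \<open>A form on a subspace \<open>L\<close> is extended by \<open>0\<close> to lists that do not lie in \<open>L\<close>, so that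
  it is determined by its values on \<open>L\<close>.\<close>

definition forms_on :: "'a::euclidean_space set \<Rightarrow> 'a form set" where
  "forms_on L = {\<alpha>.
     (\<forall>vs. \<not> set vs \<subseteq> L \<longrightarrow> \<alpha> vs = 0) \<and>
     (\<forall>xs ys u v. set (xs @ ys) \<subseteq> L \<and> u \<in> L \<and> v \<in> L \<longrightarrow>
        \<alpha> (xs @ (u + v) # ys) = \<alpha> (xs @ u # ys) + \<alpha> (xs @ v # ys)) \<and>
     (\<forall>xs ys u c. set (xs @ ys) \<subseteq> L \<and> u \<in> L \<longrightarrow>
        \<alpha> (xs @ (c *\<^sub>R u) # ys) = c * \<alpha> (xs @ u # ys)) \<and>
     (\<forall>vs. \<not> distinct vs \<longrightarrow> \<alpha> vs = 0)}"

definition p_forms_on :: "'a::euclidean_space set \<Rightarrow> nat \<Rightarrow> 'a form set" where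
  "p_forms_on L p = {\<alpha> \<in> forms_on L. \<forall>vs. length vs \<noteq> p \<longrightarrow> \<alpha> vs = 0}"

definition even_forms :: "'a::euclidean_space form set" where
  "even_forms = {\<alpha> \<in> forms_on UNIV. \<forall>vs. odd (length vs) \<longrightarrow> \<alpha> vs = 0}"

definition odd_forms :: "'a::euclidean_space form set" where
  "odd_forms = {\<alpha> \<in> forms_on UNIV. \<forall>vs. even (length vs) \<longrightarrow> \<alpha> vs = 0}"

definition even_part :: "('a list \<Rightarrow> 'b::zero) \<Rightarrow> 'a list \<Rightarrow> 'b" where
  "even_part \<alpha> = (\<lambda>vs. if even (length vs) then \<alpha> vs else 0)"

definition odd_part :: "('a list \<Rightarrow> 'b::zero) \<Rightarrow> 'a list \<Rightarrow> 'b" where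
  "odd_part \<alpha> = (\<lambda>vs. if odd (length vs) then \<alpha> vs else 0)"

definition re_form :: "('a list \<Rightarrow> complex) \<Rightarrow> 'a form" where
  "re_form \<alpha> = (\<lambda>vs. Re (\<alpha> vs))"

text \<open>The sign of the permutation of \<open>{..<m}\<close> that lists \<open>I\<close> and then its complement, each in
  increasing order.\<close>

definition shuffle_sign :: "nat \<Rightarrow> nat set \<Rightarrow> real" where
  "shuffle_sign m I = (-1) ^ card {(i, j). i \<in> I \<and> j \<in> {..<m} - I \<and> j < i}"

text \<open>The wedge product as a sum over shuffles, so that
  \<open>(\<alpha> \<and> \<beta>)(u, v) = \<alpha>(u) \<beta>(v) - \<alpha>(v) \<beta>(u)\<close> for one-forms.\<close>

definition wedge :: "'a form \<Rightarrow> 'a form \<Rightarrow> 'a form" where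
  "wedge \<alpha> \<beta> = (\<lambda>vs. \<Sum>I\<in>Pow {..<length vs}.
      shuffle_sign (length vs) I * \<alpha> (nths vs I) * \<beta> (nths vs ({..<length vs} - I)))"

definition one_form :: "'a form" where
  \<comment> \<open>the constant \<open>1\<close> of degree \<open>0\<close>\<close>
  "one_form = (\<lambda>vs. if vs = [] then 1 else 0)"

definition flat :: "'a::euclidean_space \<Rightarrow> 'a form" where
  \<comment> \<open>the covector \<open>g(v, \<cdot>)\<close>\<close>
  "flat v = (\<lambda>vs. if length vs = 1 then v \<bullet> hd vs else 0)"

text \<open>The exponential of a two-form; the sum stops at \<open>n\<close> since all terms of degree above \<open>n\<close>
  vanish.\<close>

definition exp_form :: "'a::euclidean_space form \<Rightarrow> 'a form" where
  "exp_form B = (\<lambda>vs. \<Sum>j\<le>DIM('a). (wedge B ^^ j) one_form vs / fact j)"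

definition hat :: "'a form \<Rightarrow> 'a form" where
  "hat \<alpha> = (\<lambda>vs. (-1) ^ (length vs * (length vs + 1) div 2) * \<alpha> vs)"

section \<open>Metric and orientation\<close>

definition orthonormal_basis :: "'a::euclidean_space set \<Rightarrow> 'a list \<Rightarrow> bool" where
  "orthonormal_basis L vs \<longleftrightarrow>
     distinct vs \<and> pairwise orthogonal (set vs) \<and> (\<forall>v\<in>set vs. norm v = 1) \<and> span (set vs) = L"

text \<open>\<open>e_K\<close> for \<open>K \<subseteq> {..<n}\<close>, the wedge product of the \<open>e_k\<close>, \<open>k \<in> K\<close>, in increasing order.\<close>

definition basis_form :: "'a::euclidean_space list \<Rightarrow> nat set \<Rightarrow> 'a form" where
  "basis_form es K = foldr wedge (map flat (nths es K)) one_form"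

definition vol_form :: "'a::euclidean_space list \<Rightarrow> 'a form" where
  "vol_form es = basis_form es {..<length es}"

definition form_norm :: "'a::euclidean_space list \<Rightarrow> 'a form \<Rightarrow> real" where
  "form_norm es \<alpha> = sqrt (\<Sum>K\<in>Pow {..<length es}. (\<alpha> (nths es K))\<^sup>2)"

text \<open>The linear map with \<open>\<star>e_K = \<plusminus>e_{K'}\<close>, where \<open>K'\<close> is the complement of \<open>K\<close> and the sign
  is such that \<open>e_K \<and> \<star>e_K\<close> is the volume form.\<close>

definition hodge :: "'a::euclidean_space list \<Rightarrow> 'a form \<Rightarrow> 'a form" where
  "hodge es \<alpha> = (\<lambda>vs. \<Sum>K\<in>Pow {..<length es}.
      \<alpha> (nths es K) * shuffle_sign (length es) K * basis_form es ({..<length es} - K) vs)"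

text \<open>The coefficient of the volume form in the degree \<open>n\<close> part of a form is its value on
  \<open>(e_1, ..., e_n)\<close>.\<close>

definition pairing :: "'a::euclidean_space list \<Rightarrow> 'a form \<Rightarrow> 'a form \<Rightarrow> real" where
  "pairing es \<rho> \<tau> = wedge \<rho> (hat \<tau>) es"

definition gen_norm :: "'a::euclidean_space list \<Rightarrow> 'a form \<Rightarrow> 'a form \<Rightarrow> real" where
  "gen_norm es B \<tau> = form_norm es (wedge (exp_form (\<lambda>vs. - B vs)) \<tau>)"

section \<open>Isotropic pairs and calibrations\<close>

definition orth_proj :: "'a::euclidean_space set \<Rightarrow> 'a \<Rightarrow> 'a" where
  "orth_proj L x = (THE y. y \<in> L \<and> (\<forall>z\<in>L. (x - y) \<bullet> z = 0))"

definition pull_back :: "('a \<Rightarrow> 'a) \<Rightarrow> 'a form \<Rightarrow> 'a form" where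
  "pull_back f \<alpha> = (\<lambda>vs. \<alpha> (map f vs))"

text \<open>An orientation of a subspace is given by its volume form. For \<open>L = {0}\<close> there are two of
  them, the constants \<open>1\<close> and \<open>-1\<close>.\<close>

definition is_vol_form :: "'a::euclidean_space set \<Rightarrow> 'a form \<Rightarrow> bool" where
  "is_vol_form L \<omega> \<longleftrightarrow> \<omega> \<in> p_forms_on L (dim L) \<and> (\<exists>ls. orthonormal_basis L ls \<and> \<bar>\<omega> ls\<bar> = 1)"

definition isotropic_pair :: "'a::euclidean_space set \<Rightarrow> 'a form \<Rightarrow> 'a form \<Rightarrow> bool" where
  "isotropic_pair L \<omega> F \<longleftrightarrow> subspace L \<and> is_vol_form L \<omega> \<and> F \<in> p_forms_on L 2"

definition tau :: "'a::euclidean_space list \<Rightarrow> 'a set \<Rightarrow> 'a form \<Rightarrow> 'a form \<Rightarrow> 'a form" where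
  "tau es L \<omega> F = wedge (exp_form (pull_back (orth_proj L) F))
                        (hat (hodge es (pull_back (orth_proj L) \<omega>)))"

definition gen_calibration :: "'a::euclidean_space list \<Rightarrow> 'a form \<Rightarrow> 'a form \<Rightarrow> bool" where
  "gen_calibration es B \<rho> \<longleftrightarrow>
     (\<rho> \<in> even_forms \<or> \<rho> \<in> odd_forms) \<and>
     (\<forall>L \<omega> F. isotropic_pair L \<omega> F \<longrightarrow>
        pairing es \<rho> (tau es L \<omega> F) \<le> gen_norm es B (tau es L \<omega> F)) \<and>
     (\<exists>L \<omega> F. isotropic_pair L \<omega> F \<and>
        pairing es \<rho> (tau es L \<omega> F) = gen_norm es B (tau es L \<omega> F))"

section \<open>Spinors\<close>

text \<open>The action of the form \<open>\<Sum>_K a_K e_K\<close> as the Clifford element \<open>\<Sum>_K a_K e_{k_1} \<cdots> e_{k_p}\<close>,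
  where \<open>cl\<close> is the Clifford multiplication by vectors.\<close>

definition act :: "'a::euclidean_space list \<Rightarrow> ('a \<Rightarrow> complex ^ 'd \<Rightarrow> complex ^ 'd) \<Rightarrow> 'a form \<Rightarrow>
    complex ^ 'd \<Rightarrow> complex ^ ('d::finite)" where
  "act es cl \<alpha> \<Psi> = (\<Sum>K\<in>Pow {..<length es}. \<alpha> (nths es K) *\<^sub>R foldr cl (nths es K) \<Psi>)"

text \<open>The complex spin representation: by its dimension, the module is irreducible over the
  Clifford algebra, and for odd \<open>n\<close> the volume element singles out one of the two irreducible
  modules. The map \<open>q\<close> is determined up to a positive factor, and \<open>A\<close> up to a unit complex
  factor.\<close>

locale spin_representation =
  fixes es :: "'a::euclidean_space list"
    and cl :: "'a \<Rightarrow> complex ^ 'd \<Rightarrow> complex ^ ('d::finite)"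
    and q :: "complex ^ 'd \<Rightarrow> complex ^ 'd \<Rightarrow> complex"
    and A :: "complex ^ 'd \<Rightarrow> complex ^ 'd"
  assumes frame: "orthonormal_basis UNIV es"
    and spinor_dim: "CARD('d) = 2 ^ (DIM('a) div 2)"
    and cl_linear: "linear (\<lambda>v. cl v \<Psi>)"
    and cl_add: "cl v (\<Psi> + \<Phi>) = cl v \<Psi> + cl v \<Phi>"
    and cl_scale: "cl v (c *s \<Psi>) = c *s cl v \<Psi>"
    and cl_square: "cl v (cl v \<Psi>) = - ((v \<bullet> v) *\<^sub>R \<Psi>)"
    and cl_volume: "DIM('a) = 2 * m + 1 \<Longrightarrow>
          act es cl (vol_form es) \<Psi> = ((-1) ^ (m * (m + 1) div 2) * \<i> ^ (m + 1)) *s \<Psi>"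
    and q_add: "q \<Psi> (\<Phi> + \<Phi>') = q \<Psi> \<Phi> + q \<Psi> \<Phi>'"
    and q_scale: "q \<Psi> (c *s \<Phi>) = c * q \<Psi> \<Phi>"
    and q_hermitian: "q \<Phi> \<Psi> = cnj (q \<Psi> \<Phi>)"
    and q_pos: "\<Psi> \<noteq> 0 \<Longrightarrow> 0 < Re (q \<Psi> \<Psi>)"
    and q_adjoint: "a \<in> forms_on UNIV \<Longrightarrow> q (act es cl a \<Psi>) \<Phi> = q \<Psi> (act es cl (hat a) \<Phi>)"
    and A_add: "A (\<Psi> + \<Phi>) = A \<Psi> + A \<Phi>"
    and A_scale: "A (c *s \<Psi>) = cnj c *s A \<Psi>"
    and A_cl: "m = DIM('a) div 2 \<Longrightarrow> A (cl v \<Psi>) = (-1) ^ (m + 1) *s cl v (A \<Psi>)"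
    and A_square: "m = DIM('a) div 2 \<Longrightarrow> A (A \<Psi>) = (-1) ^ (m * (m + 1) div 2) *s \<Psi>"

text \<open>For \<open>n = 2m\<close> and \<open>s = \<plusminus>1\<close>, the half-spinors \<open>\<Delta>_{n,\<plusminus>}\<close>.\<close>

definition half_spinors :: "'a::euclidean_space list \<Rightarrow> ('a \<Rightarrow> complex ^ 'd \<Rightarrow> complex ^ 'd) \<Rightarrow>
    complex \<Rightarrow> (complex ^ ('d::finite)) set" where
  "half_spinors es cl s = (let m = DIM('a) div 2 in
     {\<Psi>. act es cl (vol_form es) \<Psi> = (s * (-1) ^ (m * (m + 1) div 2) * \<i> ^ m) *s \<Psi>})"

definition fierz :: "'a::euclidean_space list \<Rightarrow> ('a \<Rightarrow> complex ^ 'd \<Rightarrow> complex ^ 'd) \<Rightarrow>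
    (complex ^ 'd \<Rightarrow> complex ^ 'd \<Rightarrow> complex) \<Rightarrow> (complex ^ 'd \<Rightarrow> complex ^ 'd) \<Rightarrow>
    complex ^ 'd \<Rightarrow> complex ^ ('d::finite) \<Rightarrow> 'a list \<Rightarrow> complex" where
  "fierz es cl q A \<Psi>L \<Psi>R = (\<lambda>vs. \<Sum>K\<in>Pow {..<length es}.
      q (A \<Psi>L) (act es cl (basis_form es K) \<Psi>R) * of_real (basis_form es K vs))"

text \<open>The form \<open>e^{-B} \<and> \<tau>_{L,F}\<close>, normalised to length one.\<close>

definition unit_tau :: "'a::euclidean_space list \<Rightarrow> 'a form \<Rightarrow> 'a set \<Rightarrow> 'a form \<Rightarrow> 'a form \<Rightarrow> 'a form"
  where
  "unit_tau es B L \<omega> F = (\<lambda>vs. wedge (exp_form (\<lambda>us. - B us)) (tau es L \<omega> F) vs /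
                                gen_norm es B (tau es L \<omega> F))"

text \<open>The equation between \<open>A \<Psi>L\<close> and \<open>\<Psi>R\<close> that characterises the isotropic pairs which meet the
  calibration bound; the two conjuncts concern even and odd \<open>n\<close>, respectively.\<close>

definition spinor_condition :: "'a::euclidean_space list \<Rightarrow> ('a \<Rightarrow> complex ^ 'd \<Rightarrow> complex ^ 'd) \<Rightarrow>
    (complex ^ 'd \<Rightarrow> complex ^ 'd) \<Rightarrow> 'a form \<Rightarrow> complex ^ 'd \<Rightarrow> complex ^ ('d::finite) \<Rightarrow>
    'a set \<Rightarrow> 'a form \<Rightarrow> 'a form \<Rightarrow> bool" where
  "spinor_condition es cl A B \<Psi>L \<Psi>R L \<omega> F \<longleftrightarrow>
     (\<forall>m s. DIM('a) = 2 * m \<and> s \<in> {1, -1} \<and> \<Psi>R \<in> half_spinors es cl s \<longrightarrow>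
        A \<Psi>L = (s * (-1) ^ (m * (m + 1) div 2 + dim L) * \<i> ^ m) *s
                 act es cl (unit_tau es B L \<omega> F) \<Psi>R) \<and>
     (\<forall>m. DIM('a) = 2 * m + 1 \<longrightarrow>
        A \<Psi>L = ((-1) ^ (m * (m + 1) div 2) * \<i> ^ (m + 1)) *s
                 act es cl (unit_tau es B L \<omega> F) \<Psi>R)"

end

theory Submission
  imports Defs
begin

text \<open>
  Contraction with a vector is an antiderivation of the wedge product of arbitrary functions on
  lists, so identities between forms follow by induction on the list of arguments. Under the
  identification with Clifford elements \<open>v \<and> \<alpha>\<close> acts as \<open>v \<cdot> \<alpha> + \<iota>\<^sub>v \<alpha>\<close>, which makes the action
  independent of the orthonormal frame.

  Put \<open>\<beta> = e\<^sup>-\<^sup>B \<and> \<tau>\<close>. Moving \<open>e\<^sup>B\<close> to the other side of the pairing and summing over the frame turns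
  \<open>\<langle>\<rho>, \<tau>\<rangle>\<close> into \<open>Re q(A \<Psi>\<^sub>L, vol \<cdot> \<beta> \<cdot> \<Psi>\<^sub>R)\<close>, up to the parity of \<open>\<beta>\<close>. In an orthonormal basis of \<open>L\<close> that
  brings the restriction of \<open>F - B\<close> to its skew normal form, \<open>\<beta>\<close> is a multiple of a Clifford product
  of unit vectors and of factors \<open>1 + \<lambda> u v\<close>, so it acts as an isometry times its norm. Since \<open>A\<close>
  is an isometry too, the bound and its equality case are those of the Cauchy-Schwarz inequality.
\<close>

section \<open>The wedge product as a derivation recursion\<close>

text \<open>The obstacle is that a form of norm one need not act on spinors as an isometry, so the
  Cauchy-Schwarz inequality gives the right constant only because of the special shape of
  \<open>\<beta>\<close>. The Hodge dual of the volume form of \<open>L\<close> is a multiple of the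
  volume form of the normal space. It annihilates each part of \<open>F - B\<close> that contains a
  normal covector, so only the restriction to \<open>L\<close> survives; and contraction with a
  vector of \<open>L\<close> kills it, so that wedging it with vectors of \<open>L\<close> is
  Clifford multiplication.

  The volume element enters because of \<open>hat\<close>: a product of p orthonormal vectors has
  Clifford square (-1)^(p(p+1)/2), the very sign of \<open>hat\<close> in degree p. The scalar by
  which the volume element acts, on a half-spinor for even \<open>n\<close> and on all spinors for
  odd \<open>n\<close>, is then the constant in the two spinor equations.

  \<open>q\<close> and \<open>A\<close> are given by algebraic rules only. \<open>A\<close> turns
  out to preserve \<open>q\<close> up to one positive constant, and the rule for
  \<open>A (A \<Psi>)\<close> forces this constant to be 1.\<close>

lemma sum_Pow_lessThan_Suc:
  fixes f :: "nat set \<Rightarrow> 'b::comm_monoid_add"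
  shows "(\<Sum>I\<in>Pow {..<Suc n}. f I) =
    (\<Sum>J\<in>Pow {..<n}. f (insert 0 (Suc ` J))) + (\<Sum>J\<in>Pow {..<n}. f (Suc ` J))"
proof -
  have P: "Pow {..<Suc n} = (\<lambda>J. insert 0 (Suc ` J)) ` Pow {..<n} \<union> (\<lambda>J. Suc ` J) ` Pow {..<n}"
    unfolding lessThan_Suc_eq_insert_0 Pow_insert image_Pow_surj[OF refl, of Suc, symmetric]
    by (simp add: image_image Un_commute)
  have i: "inj_on (\<lambda>J. insert 0 (Suc ` J)) (Pow {..<n})" "inj_on (\<lambda>J. Suc ` J) (Pow {..<n})"
    by (auto simp: inj_on_def)
  show ?thesis
    unfolding P using i
    by (subst sum.union_disjoint) (auto simp: sum.reindex)
qed

lemma nths_Cons_image_Suc [simp]: "nths (x # xs) (Suc ` J) = nths xs J"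
  by (simp add: nths_Cons image_iff)

lemma nths_Cons_insert_0 [simp]: "nths (x # xs) (insert 0 (Suc ` J)) = x # nths xs J"
  by (simp add: nths_Cons image_iff)

lemma length_nths_subset: "J \<subseteq> {..<length xs} \<Longrightarrow> length (nths xs J) = card J"
  by (auto simp: length_nths intro!: arg_cong[where f = card])

lemma shuffle_sign_insert_0: "shuffle_sign (Suc n) (insert 0 (Suc ` J)) = shuffle_sign n J"
proof -
  have "{(i, j). i \<in> insert 0 (Suc ` J) \<and> j \<in> {..<Suc n} - insert 0 (Suc ` J) \<and> j < i} =
      map_prod Suc Suc ` {(i, j). i \<in> J \<and> j \<in> {..<n} - J \<and> j < i}"
    by (auto simp: map_prod_def image_iff less_Suc_eq_0_disj)
  then show ?thesis
    unfolding shuffle_sign_def by (simp add: card_image prod.inj_map inj_on_subset[OF prod.inj_map])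
qed

text \<open>Position 0 now lies in the complement and precedes every element of the shifted
  \<open>J\<close>, which adds \<open>card J\<close> inversions. This sign becomes
  \<open>involute\<close> in the Leibniz rule.\<close>

lemma shuffle_sign_Suc:
  assumes "finite J"
  shows "shuffle_sign (Suc n) (Suc ` J) = (-1) ^ card J * shuffle_sign n J"
proof -
  have e: "{(i, j). i \<in> Suc ` J \<and> j \<in> {..<Suc n} - Suc ` J \<and> j < i} =
      (\<lambda>i. (Suc i, 0)) ` J \<union> map_prod Suc Suc ` {(i, j). i \<in> J \<and> j \<in> {..<n} - J \<and> j < i}"
    by (auto simp: map_prod_def image_iff less_Suc_eq_0_disj)
  have f: "finite {(i, j). i \<in> J \<and> j \<in> {..<n} - J \<and> j < i}"
    by (rule finite_subset[of _ "J \<times> {..<n}"]) (use assms in auto)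
  show ?thesis
    unfolding shuffle_sign_def e
    by (subst card_Un_disjoint)
      (use assms f in \<open>auto simp: power_add card_image inj_on_def prod.inj_map inj_on_subset[OF prod.inj_map]\<close>)
qed

text \<open>The interior product. As it fixes the first argument of a function on lists, it is also
  the step of every induction on the argument list.\<close>

definition contract :: "'a \<Rightarrow> 'a form \<Rightarrow> 'a form" where
  "contract v \<alpha> = (\<lambda>vs. \<alpha> (v # vs))"

text \<open>The grading automorphism of the exterior algebra. Parity of a form is stated below as an
  eigenvalue equation for it.\<close>

definition involute :: "'a form \<Rightarrow> 'a form" where
  "involute \<alpha> = (\<lambda>vs. (-1) ^ length vs * \<alpha> vs)"

lemma contract_add [simp]: "contract v (\<lambda>vs. \<alpha> vs + \<beta> vs) = (\<lambda>vs. contract v \<alpha> vs + contract v \<beta> vs)"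
  and contract_diff [simp]: "contract v (\<lambda>vs. \<alpha> vs - \<beta> vs) = (\<lambda>vs. contract v \<alpha> vs - contract v \<beta> vs)"
  and contract_minus [simp]: "contract v (\<lambda>vs. - \<alpha> vs) = (\<lambda>vs. - contract v \<alpha> vs)"
  and contract_scale [simp]: "contract v (\<lambda>vs. c * \<alpha> vs) = (\<lambda>vs. c * contract v \<alpha> vs)"
  and contract_zero [simp]: "contract v (\<lambda>vs. 0) = (\<lambda>vs. 0)"
  and contract_involute: "contract v (involute \<alpha>) = (\<lambda>vs. - involute (contract v \<alpha>) vs)"
  and contract_one [simp]: "contract v one_form = (\<lambda>vs. 0)"
  by (auto simp: contract_def involute_def one_form_def fun_eq_iff)

lemma contract_flat [simp]: "contract v (flat u) = (\<lambda>vs. (u \<bullet> v) * one_form vs)"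
  by (auto simp: contract_def one_form_def flat_def fun_eq_iff)

lemma involute_add [simp]: "involute (\<lambda>vs. \<alpha> vs + \<beta> vs) = (\<lambda>vs. involute \<alpha> vs + involute \<beta> vs)"
  and involute_minus [simp]: "involute (\<lambda>vs. - \<alpha> vs) = (\<lambda>vs. - involute \<alpha> vs)"
  and involute_scale [simp]: "involute (\<lambda>vs. c * \<alpha> vs) = (\<lambda>vs. c * involute \<alpha> vs)"
  and involute_zero [simp]: "involute (\<lambda>vs. 0) = (\<lambda>vs. 0)"
  and involute_one [simp]: "involute one_form = one_form"
  and involute_involute [simp]: "involute (involute \<alpha>) = \<alpha>"
  by (auto simp: involute_def fun_eq_iff algebra_simps one_form_def)

lemma involute_flat [simp]: "involute (flat v) = (\<lambda>vs. - flat v vs)"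
  by (auto simp: involute_def fun_eq_iff flat_def)

lemma wedge_Nil [simp]: "wedge \<alpha> \<beta> [] = \<alpha> [] * \<beta> []"
  by (simp add: wedge_def shuffle_sign_def)

text \<open>Shuffles are split by whether position 0 goes to the first factor; if it does not,
  \<open>v\<close> has to pass the arguments of \<open>\<alpha>\<close>, whence
  \<open>involute\<close>. With \<open>wedge_Nil\<close> this is the recursion behind the algebraic
  laws below.\<close>

lemma wedge_Cons:
  "wedge \<alpha> \<beta> (v # vs) = wedge (contract v \<alpha>) \<beta> vs + wedge (involute \<alpha>) (contract v \<beta>) vs"
proof -
  have c: "{..<Suc (length vs)} - insert 0 (Suc ` J) = Suc ` ({..<length vs} - J)"
    "{..<Suc (length vs)} - Suc ` J = insert 0 (Suc ` ({..<length vs} - J))" for J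
    by (force simp: less_Suc_eq_0_disj)+
  have f: "finite J" "length (nths vs J) = card J" if "J \<in> Pow {..<length vs}" for J
    using that by (auto simp: length_nths_subset finite_subset)
  show ?thesis
    unfolding wedge_def length_Cons sum_Pow_lessThan_Suc
    by (intro arg_cong2[where f = "(+)"] sum.cong refl)
      (simp_all add: c shuffle_sign_insert_0 shuffle_sign_Suc f contract_def involute_def)
qed

lemma wedge_add_left: "wedge (\<lambda>vs. \<alpha> vs + \<alpha>' vs) \<beta> vs = wedge \<alpha> \<beta> vs + wedge \<alpha>' \<beta> vs"
  and wedge_add_right: "wedge \<beta> (\<lambda>vs. \<alpha> vs + \<alpha>' vs) vs = wedge \<beta> \<alpha> vs + wedge \<beta> \<alpha>' vs"
  and wedge_diff_left: "wedge (\<lambda>vs. \<alpha> vs - \<alpha>' vs) \<beta> vs = wedge \<alpha> \<beta> vs - wedge \<alpha>' \<beta> vs"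
  and wedge_diff_right: "wedge \<beta> (\<lambda>vs. \<alpha> vs - \<alpha>' vs) vs = wedge \<beta> \<alpha> vs - wedge \<beta> \<alpha>' vs"
  and wedge_minus_left: "wedge (\<lambda>vs. - \<alpha> vs) \<beta> vs = - wedge \<alpha> \<beta> vs"
  and wedge_minus_right: "wedge \<beta> (\<lambda>vs. - \<alpha> vs) vs = - wedge \<beta> \<alpha> vs"
  and wedge_scale_left: "wedge (\<lambda>vs. c * \<alpha> vs) \<beta> vs = c * wedge \<alpha> \<beta> vs"
  and wedge_scale_right: "wedge \<beta> (\<lambda>vs. c * \<alpha> vs) vs = c * wedge \<beta> \<alpha> vs"
  and wedge_zero_left: "wedge (\<lambda>vs. 0) \<beta> vs = 0"
  and wedge_zero_right: "wedge \<beta> (\<lambda>vs. 0) vs = 0"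
  by (auto simp: wedge_def algebra_simps sum.distrib sum_subtractf sum_negf sum_distrib_left)

lemma wedge_sum_left: "wedge (\<lambda>vs. \<Sum>i\<in>S. f i vs) \<beta> vs = (\<Sum>i\<in>S. wedge (f i) \<beta> vs)"
  and wedge_sum_right: "wedge \<beta> (\<lambda>vs. \<Sum>i\<in>S. f i vs) vs = (\<Sum>i\<in>S. wedge \<beta> (f i) vs)"
  by (induction S rule: infinite_finite_induct)
    (simp_all add: wedge_zero_left wedge_zero_right wedge_add_left wedge_add_right)

lemmas wedge_linear = wedge_add_left wedge_add_right wedge_diff_left wedge_diff_right
  wedge_minus_left wedge_minus_right wedge_scale_left wedge_scale_right wedge_zero_left
  wedge_zero_right

lemma contract_wedge:
  "contract v (wedge \<alpha> \<beta>) =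
    (\<lambda>vs. wedge (contract v \<alpha>) \<beta> vs + wedge (involute \<alpha>) (contract v \<beta>) vs)"
  by (simp add: fun_eq_iff contract_def[of _ "wedge _ _"] wedge_Cons)

lemma form_ext:
  assumes "\<alpha> [] = \<beta> []" "\<And>v. contract v \<alpha> = contract v \<beta>"
  shows "\<alpha> = \<beta>"
proof
  fix vs show "\<alpha> vs = \<beta> vs"
    using assms(1) fun_cong[OF assms(2)] by (cases vs) (auto simp: contract_def)
qed

lemma involute_Cons: "involute \<alpha> (v # vs) = - involute (contract v \<alpha>) vs"
  and involute_Nil [simp]: "involute \<alpha> [] = \<alpha> []"
  by (simp_all add: involute_def contract_def)

lemma involute_wedge: "involute (wedge \<alpha> \<beta>) = wedge (involute \<alpha>) (involute \<beta>)"
proof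
  show "involute (wedge \<alpha> \<beta>) vs = wedge (involute \<alpha>) (involute \<beta>) vs" for vs
    by (induction vs arbitrary: \<alpha> \<beta>)
      (simp_all add: involute_Cons wedge_Cons contract_wedge contract_involute wedge_linear)
qed

lemma wedge_assoc: "wedge (wedge \<alpha> \<beta>) \<gamma> = wedge \<alpha> (wedge \<beta> \<gamma>)"
proof
  show "wedge (wedge \<alpha> \<beta>) \<gamma> vs = wedge \<alpha> (wedge \<beta> \<gamma>) vs" for vs
    by (induction vs arbitrary: \<alpha> \<beta> \<gamma>)
      (simp_all add: wedge_Cons contract_wedge involute_wedge wedge_linear)
qed

lemma one_form_Nil [simp]: "one_form [] = 1"
  by (simp add: one_form_def)

lemma wedge_one_left [simp]: "wedge one_form \<alpha> = \<alpha>"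
proof
  show "wedge one_form \<alpha> vs = \<alpha> vs" for vs
    by (induction vs arbitrary: \<alpha>)
      (simp_all add: wedge_Cons wedge_linear, simp_all add: contract_def)
qed

lemma wedge_one_right [simp]: "wedge \<alpha> one_form = \<alpha>"
proof
  show "wedge \<alpha> one_form vs = \<alpha> vs" for vs
    by (induction vs arbitrary: \<alpha>)
      (simp_all add: wedge_Cons wedge_linear, simp_all add: contract_def)
qed

text \<open>Contraction flips parity, so the even and the odd case feed each other in the induction
  and are proved together.\<close>

lemma wedge_commute_graded:
  "(involute \<alpha> = \<alpha> \<longrightarrow> wedge \<alpha> \<beta> vs = wedge \<beta> \<alpha> vs) \<and>
   (involute \<alpha> = (\<lambda>vs. - \<alpha> vs) \<longrightarrow> wedge \<alpha> \<beta> vs = wedge (involute \<beta>) \<alpha> vs)"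
proof (induction vs arbitrary: \<alpha> \<beta>)
  case Nil
  show ?case by simp
next
  case (Cons v vs)
  have o: "involute (contract v \<alpha>) = (\<lambda>vs. - contract v \<alpha> vs)" if "involute \<alpha> = \<alpha>"
    using contract_involute[of v \<alpha>] that by (simp add: fun_eq_iff)
  have e: "involute (contract v \<alpha>) = contract v \<alpha>" if "involute \<alpha> = (\<lambda>vs. - \<alpha> vs)"
    using contract_involute[of v \<alpha>] that by (simp add: fun_eq_iff)
  show ?case
    using Cons.IH[of "contract v \<alpha>"] Cons.IH[of \<alpha>] o e
    by (auto simp: wedge_Cons wedge_linear contract_involute)
qed

lemma wedge_commute_even: "involute \<alpha> = \<alpha> \<Longrightarrow> wedge \<alpha> \<beta> = wedge \<beta> \<alpha>"
  using wedge_commute_graded by blast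

lemma wedge_commute_odd:
  "involute \<alpha> = (\<lambda>vs. - \<alpha> vs) \<Longrightarrow> wedge \<alpha> \<beta> = wedge (involute \<beta>) \<alpha>"
  using wedge_commute_graded by blast

lemma wedge_flat_flat: "wedge (flat u) (flat u) = (\<lambda>vs. 0)"
  using wedge_commute_odd[of "flat u" "flat u"] by (simp add: fun_eq_iff wedge_linear)

lemma wedge_flat_swap: "wedge (flat u) (wedge (flat v) \<alpha>) = (\<lambda>vs. - wedge (flat v) (wedge (flat u) \<alpha>) vs)"
proof -
  have "wedge (flat u) (flat v) = (\<lambda>vs. - wedge (flat v) (flat u) vs)"
    using wedge_commute_odd[of "flat u" "flat v"] by (simp add: fun_eq_iff wedge_linear)
  then show ?thesis
    by (simp only: wedge_assoc[symmetric]) (simp add: fun_eq_iff wedge_minus_left)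
qed

lemma contract_wedge_flat:
  "contract v (wedge (flat u) \<alpha>) = (\<lambda>vs. (u \<bullet> v) * \<alpha> vs - wedge (flat u) (contract v \<alpha>) vs)"
  by (simp add: contract_wedge wedge_linear)

text \<open>In degree p of the contracted form, (p+1)(p+2)/2 = p(p+1)/2 + (p+1); the extra p+1 signs
  are \<open>involute\<close> and one minus.\<close>

lemma contract_hat: "contract v (hat \<alpha>) = (\<lambda>vs. - involute (hat (contract v \<alpha>)) vs)"
proof
  fix vs :: "'a list"
  define n where "n = length vs"
  have e: "Suc n * (Suc n + 1) div 2 = n * (n + 1) div 2 + Suc n"
    using div_mult_self1[of 2 "n * (n + 1)" "Suc n"] by (simp add: algebra_simps)
  have "(-1::real) ^ (Suc n * (Suc n + 1) div 2) = - ((-1) ^ n * (-1) ^ (n * (n + 1) div 2))"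
    unfolding e power_add by simp
  then show "contract v (hat \<alpha>) vs = - involute (hat (contract v \<alpha>)) vs"
    unfolding contract_def hat_def involute_def length_Cons n_def by (simp only: mult.assoc mult_minus_left)
qed

lemma hat_Nil [simp]: "hat \<alpha> [] = \<alpha> []"
  by (simp add: hat_def)

lemma hat_Cons: "hat \<alpha> (v # vs) = - involute (hat (contract v \<alpha>)) vs"
  using contract_hat[of v \<alpha>] by (simp add: contract_def fun_eq_iff)

lemma hat_add [simp]: "hat (\<lambda>vs. \<alpha> vs + \<beta> vs) = (\<lambda>vs. hat \<alpha> vs + hat \<beta> vs)"
  and hat_minus [simp]: "hat (\<lambda>vs. - \<alpha> vs) = (\<lambda>vs. - hat \<alpha> vs)"
  and hat_scale [simp]: "hat (\<lambda>vs. c * \<alpha> vs) = (\<lambda>vs. c * hat \<alpha> vs)"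
  and hat_involute: "hat (involute \<alpha>) = involute (hat \<alpha>)"
  by (auto simp: hat_def involute_def distrib_left)

lemma hat_flat [simp]: "hat (flat v) = (\<lambda>vs. - flat v vs)"
  by (auto simp: hat_def fun_eq_iff flat_def)

text \<open>The sign (-1)^(p(p+1)/2) is that of reversing p covectors times (-1)^p, so
  \<open>hat\<close> is an antiautomorphism.\<close>

lemma hat_wedge: "hat (wedge \<alpha> \<beta>) = wedge (hat \<beta>) (hat \<alpha>)"
proof
  show "hat (wedge \<alpha> \<beta>) vs = wedge (hat \<beta>) (hat \<alpha>) vs" for vs
  proof (induction vs arbitrary: \<alpha> \<beta>)
    case Nil
    show ?case by simp
  next
    case (Cons v vs)
    have "involute (hat (wedge \<alpha> \<beta>)) vs = wedge (involute (hat \<beta>)) (involute (hat \<alpha>)) vs" for \<alpha> \<beta>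
      using Cons.IH[of \<alpha> \<beta>] by (simp add: involute_def[of "hat (wedge _ _)"] flip: involute_wedge)
        (simp add: involute_def)
    then show ?case
      by (simp add: hat_Cons contract_wedge wedge_Cons contract_hat wedge_linear hat_involute)
  qed
qed

section \<open>Alternating forms and orthonormal frames\<close>

text \<open>Equal neighbours suffice for alternation: polarisation makes neighbouring arguments
  anticommute, and a repeated argument is then moved next to its copy.\<close>

lemma forms_UNIV_iff:
  "\<alpha> \<in> forms_on (UNIV :: 'a::euclidean_space set) \<longleftrightarrow>
    (\<forall>us vs. linear (\<lambda>v. \<alpha> (us @ v # vs))) \<and> (\<forall>us v vs. \<alpha> (us @ v # v # vs) = 0)"
    (is "_ \<longleftrightarrow> ?lin \<and> ?adj")
proof
  assume "\<alpha> \<in> forms_on UNIV"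
  then show "?lin \<and> ?adj"
    by (auto simp: forms_on_def intro!: linearI)
next
  assume R: "?lin \<and> ?adj"
  then have l: "linear (\<lambda>v. \<alpha> (us @ v # vs))" and z: "\<alpha> (us @ v # v # vs) = 0" for us v vs
    by auto
  have swap: "\<alpha> (us @ u # v # vs) = - \<alpha> (us @ v # u # vs)" for us u v vs
    using z[of us "u + v" vs] z[of us u vs] z[of us v vs]
      linear_add[OF l, of us u v "(u + v) # vs"]
      linear_add[OF l, of "us @ [u]" u v vs] linear_add[OF l, of "us @ [v]" u v vs]
    by simp
  have rep: "\<alpha> (us @ v # ws @ v # vs) = 0" for us v ws vs
  proof (induction ws arbitrary: us)
    case Nil
    show ?case using z by simp
  next
    case (Cons w ws)
    show ?case
      using Cons.IH[of "us @ [w]"] swap[of us v w "ws @ v # vs"] by simp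
  qed
  have "\<alpha> vs = 0" if nd: "\<not> distinct vs" for vs
  proof -
    obtain us v ws xs where "vs = us @ v # ws @ v # xs"
      using not_distinct_decomp[OF nd] by auto
    then show ?thesis by (simp add: rep)
  qed
  then show "\<alpha> \<in> forms_on UNIV"
    unfolding forms_on_def
    by (intro CollectI conjI allI impI) (simp, rule linear_add[OF l],
        rule linear_scale[OF l, unfolded real_scaleR_def], blast)
qed

lemma forms_linear: "\<alpha> \<in> forms_on UNIV \<Longrightarrow> linear (\<lambda>v. \<alpha> (us @ v # vs))"
  and forms_adjacent: "\<alpha> \<in> forms_on UNIV \<Longrightarrow> \<alpha> (us @ v # v # vs) = 0"
  unfolding forms_UNIV_iff by blast+

lemma forms_UNIV_I:
  assumes "\<And>us vs. linear (\<lambda>v. \<alpha> (us @ v # vs))" "\<And>us v vs. \<alpha> (us @ v # v # vs) = 0"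
  shows "\<alpha> \<in> forms_on UNIV"
  unfolding forms_UNIV_iff using assms by blast

lemma forms_contract:
  assumes "\<alpha> \<in> forms_on UNIV" shows "contract w \<alpha> \<in> forms_on UNIV"
proof (rule forms_UNIV_I)
  fix us v vs
  show "linear (\<lambda>v. contract w \<alpha> (us @ v # vs))"
    using forms_linear[OF assms, of "w # us" vs] by (simp add: contract_def)
  show "contract w \<alpha> (us @ v # v # vs) = 0"
    using forms_adjacent[OF assms, of "w # us" v vs] by (simp add: contract_def)
qed

lemma wedge_zero [simp]: "wedge (\<lambda>vs. 0) \<beta> = (\<lambda>vs. 0)" "wedge \<beta> (\<lambda>vs. 0) = (\<lambda>vs. 0)"
  by (simp_all add: fun_eq_iff wedge_zero_left wedge_zero_right)

lemma linear_mult_left: "linear f \<Longrightarrow> linear (\<lambda>x. (c::real) * f x)"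
  using linear_compose_scale_right[of f c] by simp

lemma forms_length_scale:
  "\<alpha> \<in> forms_on UNIV \<Longrightarrow> (\<lambda>vs. c (length vs) * \<alpha> vs) \<in> forms_on UNIV"
  by (rule forms_UNIV_I) (simp_all add: linear_mult_left forms_linear forms_adjacent)

lemma forms_scale: "\<alpha> \<in> forms_on UNIV \<Longrightarrow> (\<lambda>vs. c * \<alpha> vs) \<in> forms_on UNIV"
  using forms_length_scale[of \<alpha> "\<lambda>_. c"] .

lemma forms_minus: "\<alpha> \<in> forms_on UNIV \<Longrightarrow> (\<lambda>vs. - \<alpha> vs) \<in> forms_on UNIV"
  using forms_scale[of \<alpha> "-1"] by simp

lemma forms_involute: "\<alpha> \<in> forms_on UNIV \<Longrightarrow> involute \<alpha> \<in> forms_on UNIV"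
  unfolding involute_def by (rule forms_length_scale)

lemma forms_even_part:
  assumes "\<alpha> \<in> forms_on UNIV" shows "even_part \<alpha> \<in> forms_on UNIV" "odd_part \<alpha> \<in> forms_on UNIV"
  using forms_length_scale[OF assms, of "\<lambda>n. of_bool (even n)"]
    forms_length_scale[OF assms, of "\<lambda>n. of_bool (odd n)"]
  by (simp_all add: even_part_def odd_part_def of_bool_def if_distrib[where f = "\<lambda>x. x * _"] cong: if_cong)

lemma forms_add:
  "\<alpha> \<in> forms_on UNIV \<Longrightarrow> \<beta> \<in> forms_on UNIV \<Longrightarrow> (\<lambda>vs. \<alpha> vs + \<beta> vs) \<in> forms_on UNIV"
  by (rule forms_UNIV_I) (simp_all add: linear_compose_add forms_linear forms_adjacent)

lemma forms_diff:
  "\<alpha> \<in> forms_on UNIV \<Longrightarrow> \<beta> \<in> forms_on UNIV \<Longrightarrow> (\<lambda>vs. \<alpha> vs - \<beta> vs) \<in> forms_on UNIV"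
  by (rule forms_UNIV_I) (simp_all add: linear_compose_sub forms_linear forms_adjacent)

lemma forms_zero: "(\<lambda>vs. 0) \<in> forms_on UNIV"
  by (rule forms_UNIV_I) (auto intro: linearI)

lemma forms_sum:
  "(\<And>i. i \<in> S \<Longrightarrow> f i \<in> forms_on UNIV) \<Longrightarrow> (\<lambda>vs. \<Sum>i\<in>S. f i vs) \<in> forms_on UNIV"
  by (induction S rule: infinite_finite_induct) (auto intro: forms_zero forms_add)

lemma forms_one: "one_form \<in> forms_on UNIV"
  by (rule forms_UNIV_I) (auto simp: one_form_def intro: linearI)

lemma forms_flat: "flat v \<in> forms_on UNIV"
proof -
  have "linear (\<lambda>u. flat v (us @ u # vs))" for us vs
  proof (cases "us = [] \<and> vs = []")
    case True
    then show ?thesis by (auto simp: flat_def intro: bounded_linear.linear[OF bounded_linear_inner_right])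
  next
    case False
    then show ?thesis
      by (auto simp: flat_def intro: linearI)
  qed
  then show ?thesis
    by (rule forms_UNIV_I) (simp add: flat_def)
qed

lemma contract_linear:
  assumes "\<alpha> \<in> forms_on UNIV"
  shows "contract (u + v) \<alpha> = (\<lambda>vs. contract u \<alpha> vs + contract v \<alpha> vs)"
    and "contract (c *\<^sub>R u) \<alpha> = (\<lambda>vs. c * contract u \<alpha> vs)"
    and "contract (u - v) \<alpha> = (\<lambda>vs. contract u \<alpha> vs - contract v \<alpha> vs)"
    and "contract 0 \<alpha> = (\<lambda>vs. 0)"
  using linear_add[OF forms_linear[OF assms, of "[]"]] linear_scale[OF forms_linear[OF assms, of "[]"]]
    linear_diff[OF forms_linear[OF assms, of "[]"]] linear_0[OF forms_linear[OF assms, of "[]"]]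
  by (auto simp: contract_def fun_eq_iff)

lemma contract_same: "\<alpha> \<in> forms_on UNIV \<Longrightarrow> contract u (contract u \<alpha>) = (\<lambda>vs. 0)"
  using forms_adjacent[of \<alpha> "[]"] by (auto simp: contract_def)

lemma contract_swap:
  assumes "\<alpha> \<in> forms_on UNIV"
  shows "contract u (contract v \<alpha>) = (\<lambda>vs. - contract v (contract u \<alpha>) vs)"
proof -
  have "contract (u + v) (contract (u + v) \<alpha>) = (\<lambda>vs. 0)"
    using contract_same[OF assms] .
  then show ?thesis
    using contract_same[OF assms, of u] contract_same[OF assms, of v]
    by (simp add: contract_linear(1) forms_contract assms fun_eq_iff add_eq_0_iff)
qed

text \<open>Contractions peel off the arguments before the slot in question; once that slot comes
  first, the Leibniz rule decides.\<close>

lemma forms_wedge: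
  assumes "\<alpha> \<in> forms_on UNIV" "\<beta> \<in> forms_on UNIV"
  shows "wedge \<alpha> \<beta> \<in> forms_on UNIV"
proof -
  have "linear (\<lambda>v. wedge \<alpha> \<beta> (us @ v # vs)) \<and> (\<forall>v. wedge \<alpha> \<beta> (us @ v # v # vs) = 0)" for us vs
    using assms
  proof (induction us arbitrary: \<alpha> \<beta>)
    case Nil
    then show ?case
      by (auto intro!: linearI simp: wedge_Cons wedge_linear contract_linear contract_wedge
          contract_involute contract_same forms_contract algebra_simps)
  next
    case (Cons u us)
    then show ?case
      by (auto simp: wedge_Cons forms_contract forms_involute intro!: linear_compose_add)
  qed
  then show ?thesis
    unfolding forms_UNIV_iff by blast
qed

section \<open>Homogeneous forms, products of covectors and expansion in a frame\<close>

lemma p_forms_UNIV_iff: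
  "\<alpha> \<in> p_forms_on UNIV p \<longleftrightarrow> \<alpha> \<in> forms_on UNIV \<and> (\<forall>vs. length vs \<noteq> p \<longrightarrow> \<alpha> vs = 0)"
  by (simp add: p_forms_on_def)

lemma p_forms_wedge:
  assumes "\<alpha> \<in> p_forms_on UNIV p" "\<beta> \<in> p_forms_on UNIV r"
  shows "wedge \<alpha> \<beta> \<in> p_forms_on UNIV (p + r)"
proof -
  have "wedge \<alpha> \<beta> vs = 0" if "length vs \<noteq> p + r" for vs
  proof -
    have "\<alpha> (nths vs I) * \<beta> (nths vs ({..<length vs} - I)) = 0" if I: "I \<subseteq> {..<length vs}" for I
    proof -
      have "length (nths vs I) + length (nths vs ({..<length vs} - I)) = length vs"
        using I card_mono[OF finite_lessThan I]
        by (simp add: length_nths_subset card_Diff_subset finite_subset)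
      then have "length (nths vs I) \<noteq> p \<or> length (nths vs ({..<length vs} - I)) \<noteq> r"
        using \<open>length vs \<noteq> p + r\<close> by auto
      then show ?thesis
        using assms by (auto simp: p_forms_UNIV_iff)
    qed
    then show ?thesis
      unfolding wedge_def by (auto intro!: sum.neutral simp: mult.assoc)
  qed
  then show ?thesis
    using assms by (auto simp: p_forms_UNIV_iff intro: forms_wedge)
qed

lemma p_forms_one: "one_form \<in> p_forms_on UNIV 0"
  unfolding p_forms_UNIV_iff using forms_one by (auto simp: one_form_def)

lemma p_forms_flat: "flat v \<in> p_forms_on UNIV 1"
  unfolding p_forms_UNIV_iff using forms_flat by (auto simp: flat_def)

lemma p_forms_involute: "\<alpha> \<in> p_forms_on UNIV p \<Longrightarrow> involute \<alpha> = (\<lambda>vs. (-1) ^ p * \<alpha> vs)"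
  by (auto simp: p_forms_UNIV_iff involute_def fun_eq_iff)

text \<open>Decomposable forms, indexed by a list of arbitrary vectors. \<open>basis_form\<close> is
  tied to index sets of one frame, whereas the normal space of \<open>L\<close> has a frame of its
  own.\<close>

primrec bform :: "'a::euclidean_space list \<Rightarrow> 'a form" where
  "bform [] = one_form"
| "bform (v # vs) = wedge (flat v) (bform vs)"

lemma basis_form_eq: "basis_form es K = bform (nths es K)"
proof -
  have "foldr wedge (map flat vs) one_form = bform vs" for vs :: "'a list"
    by (induction vs) auto
  then show ?thesis by (simp add: basis_form_def)
qed

lemma nths_lessThan_length [simp]: "nths xs {..<length xs} = xs"
  by (simp add: nths_all)

lemma vol_form_eq: "vol_form es = bform es"
  by (simp add: vol_form_def basis_form_eq)

lemma p_forms_bform: "bform us \<in> p_forms_on UNIV (length us)"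
  using p_forms_wedge[OF p_forms_flat] by (induction us) (auto simp: p_forms_one)

lemma forms_bform: "bform us \<in> forms_on UNIV"
  using p_forms_bform by (auto simp: p_forms_UNIV_iff)

lemma bform_length: "length vs \<noteq> length us \<Longrightarrow> bform us vs = 0"
  using p_forms_bform by (auto simp: p_forms_UNIV_iff)

lemma bform_append: "bform (us @ vs) = wedge (bform us) (bform vs)"
  by (induction us) (simp_all add: wedge_assoc)

lemma wedge_flat_bform_mem: "u \<in> set us \<Longrightarrow> wedge (flat u) (bform us) = (\<lambda>vs. 0)"
proof (induction us)
  case (Cons v us)
  show ?case
  proof (cases "u = v")
    case True
    then show ?thesis
      by (simp add: wedge_flat_flat flip: wedge_assoc)
  next
    case False
    then show ?thesis
      using Cons wedge_flat_swap[of u v "bform us"] by simp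
  qed
qed simp

lemma bform_not_distinct: "\<not> distinct us \<Longrightarrow> bform us = (\<lambda>vs. 0)"
  by (induction us) (auto simp: wedge_flat_bform_mem)

lemma contract_bform_orthogonal:
  "(\<And>u. u \<in> set us \<Longrightarrow> v \<bullet> u = 0) \<Longrightarrow> contract v (bform us) = (\<lambda>vs. 0)"
  by (induction us) (auto simp: contract_wedge_flat wedge_zero_right inner_commute)

lemma wedge_flat_orthogonal:
  "(\<And>v. v \<in> set vs \<Longrightarrow> u \<bullet> v = 0) \<Longrightarrow> wedge (flat u) \<alpha> vs = 0"
proof (induction vs arbitrary: \<alpha>)
  case Nil
  then show ?case by (simp add: flat_def)
next
  case (Cons v vs)
  then show ?case by (simp add: wedge_Cons wedge_linear)
qed

text \<open>Orthonormality without the spanning condition, so that it passes to the tail of a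
  frame.\<close>

primrec orthonormal_list :: "'a::euclidean_space list \<Rightarrow> bool" where
  "orthonormal_list [] \<longleftrightarrow> True"
| "orthonormal_list (e # es) \<longleftrightarrow> e \<bullet> e = 1 \<and> (\<forall>v\<in>set es. e \<bullet> v = 0) \<and> orthonormal_list es"

lemma orthonormal_basis_iff:
  "orthonormal_basis L vs \<longleftrightarrow> orthonormal_list vs \<and> span (set vs) = L"
proof -
  have "orthonormal_list vs \<longleftrightarrow>
      distinct vs \<and> pairwise orthogonal (set vs) \<and> (\<forall>v\<in>set vs. norm v = 1)"
  proof (induction vs)
    case (Cons v vs)
    have "v \<notin> set vs" if "v \<bullet> v = 1" "\<forall>w\<in>set vs. v \<bullet> w = 0"
      using that by auto
    then show ?case
      using Cons by (auto simp: pairwise_insert orthogonal_def inner_commute norm_eq_1)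
  qed simp
  then show ?thesis
    by (auto simp: orthonormal_basis_def)
qed

lemma orthonormal_list_append:
  "orthonormal_list (us @ vs) \<longleftrightarrow>
    orthonormal_list us \<and> orthonormal_list vs \<and> (\<forall>u\<in>set us. \<forall>v\<in>set vs. u \<bullet> v = 0)"
  by (induction us) auto

lemma orthonormal_listD:
  assumes "orthonormal_list vs"
  shows "distinct vs" "u \<in> set vs \<Longrightarrow> u \<bullet> u = 1" "u \<in> set vs \<Longrightarrow> v \<in> set vs \<Longrightarrow> u \<noteq> v \<Longrightarrow> u \<bullet> v = 0"
  using assms by (induction vs) (auto simp: inner_commute)

lemma Pow_lessThan_Suc_cases:
  assumes "I \<subseteq> {..<Suc n}"
  obtains J where "J \<subseteq> {..<n}" "I = Suc ` J" | J where "J \<subseteq> {..<n}" "I = insert 0 (Suc ` J)"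
proof -
  let ?J = "{j. Suc j \<in> I}"
  have J: "?J \<subseteq> {..<n}" using assms by auto
  have i: "i \<in> Suc ` ?J" if "i \<in> I" "i \<noteq> 0" for i
    using that by (cases i) auto
  show ?thesis
  proof (cases "0 \<in> I")
    case True
    then have "I = insert 0 (Suc ` ?J)" using i by auto
    then show ?thesis using that(2) J by blast
  next
    case False
    then have "I = Suc ` ?J" using i by force
    then show ?thesis using that(1) J by blast
  qed
qed

text \<open>The first vector is orthogonal to all others and pairs only with itself; hence the
  product vanishes when exactly one of \<open>I\<close>, \<open>J\<close> contains 0.\<close>

lemma bform_nths_nths:
  assumes "orthonormal_list fs" "I \<subseteq> {..<length fs}" "J \<subseteq> {..<length fs}"
  shows "bform (nths fs I) (nths fs J) = of_bool (I = J)"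
  using assms
proof (induction fs arbitrary: I J)
  case (Cons e fs)
  have o: "e \<bullet> v = 0" if "v \<in> set (nths fs K)" for v K
    using that Cons.prems(1) set_nths_subset[of fs K] by auto
  have e: "e \<bullet> e = 1" and fs: "orthonormal_list fs"
    using Cons.prems(1) by simp_all
  have 1: "bform (nths fs K) (e # vs) = 0" for K vs
    using fun_cong[OF contract_bform_orthogonal[of "nths fs K" e, OF o], where x = vs] by (simp add: contract_def)
  have 2: "bform (e # us) (nths fs K) = 0" for K us
    by (simp add: wedge_flat_orthogonal o)
  have 3: "bform (e # us) (e # nths fs K) = bform us (nths fs K)" for K us
    by (simp add: wedge_Cons wedge_linear wedge_flat_orthogonal o e)
  have i: "insert 0 (Suc ` I') = insert 0 (Suc ` J') \<longleftrightarrow> I' = J'" for I' J'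
    by auto
  have n: "insert 0 (Suc ` I') \<noteq> Suc ` J'" "Suc ` J' \<noteq> insert 0 (Suc ` I')" for I' J'
    by auto
  have "I \<subseteq> {..<Suc (length fs)}" "J \<subseteq> {..<Suc (length fs)}"
    using Cons.prems by simp_all
  then show ?case
    by (elim Pow_lessThan_Suc_cases)
      (simp_all only: nths_Cons_image_Suc nths_Cons_insert_0 1 2 3 i n inj_image_eq_iff[OF inj_Suc]
        Cons.IH[OF fs] of_bool_eq)
qed auto

text \<open>Splitting off \<open>e \<and> \<iota>\<^sub>e \<alpha>\<close> removes the direction \<open>e\<close> from \<open>\<alpha>\<close>.\<close>

lemma form_expansion_supported:
  assumes "orthonormal_list fs" "\<alpha> \<in> forms_on UNIV"
    and "\<And>w. (\<And>f. f \<in> set fs \<Longrightarrow> w \<bullet> f = 0) \<Longrightarrow> contract w \<alpha> = (\<lambda>vs. 0)"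
  shows "\<alpha> = (\<lambda>vs. \<Sum>K\<in>Pow {..<length fs}. \<alpha> (nths fs K) * bform (nths fs K) vs)"
  using assms
proof (induction fs arbitrary: \<alpha>)
  case Nil
  have "contract w \<alpha> = (\<lambda>vs. 0)" for w using Nil(3) by simp
  then have "\<alpha> [] * one_form vs = \<alpha> vs" for vs
    by (cases vs) (auto simp: one_form_def contract_def fun_eq_iff)
  then show ?case by simp
next
  case (Cons e fs)
  let ?\<beta> = "contract e \<alpha>"
  let ?\<alpha>' = "\<lambda>vs. \<alpha> vs - wedge (flat e) ?\<beta> vs"
  have \<alpha>: "\<alpha> \<in> forms_on UNIV" and e: "e \<bullet> e = 1" and fs: "orthonormal_list fs"
    and o: "\<And>f. f \<in> set fs \<Longrightarrow> e \<bullet> f = 0"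
    using Cons.prems by auto
  have split: "w = (w \<bullet> e) *\<^sub>R e + (w - (w \<bullet> e) *\<^sub>R e)" for w by simp
  \<comment> \<open>Only orthogonality to \<open>fs\<close> is assumed of \<open>w\<close>;
    subtracting the \<open>e\<close>-component makes it orthogonal to the whole list.\<close>
  have c0: "contract (w - (w \<bullet> e) *\<^sub>R e) \<alpha> = (\<lambda>vs. 0)" if "\<And>f. f \<in> set fs \<Longrightarrow> w \<bullet> f = 0" for w
    using that o e by (intro Cons.prems(3)) (auto simp: inner_diff_left)
  have c: "contract w \<alpha> = (\<lambda>vs. (w \<bullet> e) * ?\<beta> vs)" if "\<And>f. f \<in> set fs \<Longrightarrow> w \<bullet> f = 0" for w
    using c0[OF that] by (simp add: contract_linear \<alpha> fun_eq_iff)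
  have cb: "contract w ?\<beta> = (\<lambda>vs. 0)" if "\<And>f. f \<in> set fs \<Longrightarrow> w \<bullet> f = 0" for w
    using contract_swap[OF \<alpha>, of w e] c[OF that] contract_same[OF \<alpha>, of e] by (simp add: fun_eq_iff)
  have 1: "?\<alpha>' = (\<lambda>vs. \<Sum>K\<in>Pow {..<length fs}. ?\<alpha>' (nths fs K) * bform (nths fs K) vs)"
  proof (rule Cons.IH[OF fs])
    show "?\<alpha>' \<in> forms_on UNIV"
      by (intro forms_diff forms_wedge forms_flat forms_contract \<alpha>)
    fix w assume w: "\<And>f. f \<in> set fs \<Longrightarrow> w \<bullet> f = 0"
    have "contract w \<alpha> = (\<lambda>vs. (w \<bullet> e) * ?\<beta> vs)" "contract w ?\<beta> = (\<lambda>vs. 0)"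
      by (rule c cb, erule w)+
    then show "contract w ?\<alpha>' = (\<lambda>vs. 0)"
      unfolding contract_diff contract_wedge_flat by (simp add: inner_commute)
  qed
  \<comment> \<open>Hence \<open>?\<alpha>'\<close> and \<open>\<alpha>\<close> have the same
    coefficients on the remaining vectors.\<close>
  have z: "wedge (flat e) ?\<beta> (nths fs K) = 0" for K
    using o set_nths_subset[of fs K] by (intro wedge_flat_orthogonal) auto
  have 2: "?\<beta> = (\<lambda>vs. \<Sum>K\<in>Pow {..<length fs}. ?\<beta> (nths fs K) * bform (nths fs K) vs)"
    by (rule Cons.IH[OF fs forms_contract[OF \<alpha>] cb]) simp
  have 3: "wedge (flat e) ?\<beta> vs =
      (\<Sum>K\<in>Pow {..<length fs}. ?\<beta> (nths fs K) * wedge (flat e) (bform (nths fs K)) vs)" for vs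
    by (subst 2) (simp add: wedge_sum_right wedge_scale_right)
  show ?case
  proof
    fix vs
    have "\<alpha> vs = wedge (flat e) ?\<beta> vs + ?\<alpha>' vs" by simp
    also have "?\<alpha>' vs = (\<Sum>K\<in>Pow {..<length fs}. \<alpha> (nths fs K) * bform (nths fs K) vs)"
      using fun_cong[OF 1, of vs] by (simp only: z diff_0_right)
    finally show "\<alpha> vs = (\<Sum>K\<in>Pow {..<length (e # fs)}. \<alpha> (nths (e # fs) K) * bform (nths (e # fs) K) vs)"
      unfolding 3 by (simp add: sum_Pow_lessThan_Suc contract_def)
  qed
qed

lemma orthogonal_spanning_zero:
  fixes w :: "'a::euclidean_space"
  assumes "span S = UNIV" "\<And>f. f \<in> S \<Longrightarrow> w \<bullet> f = 0"
  shows "w = 0"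
proof -
  have "orthogonal w w"
    by (rule orthogonal_to_span[of w S]) (use assms in \<open>auto simp: orthogonal_def\<close>)
  then show ?thesis by (simp add: orthogonal_def)
qed

lemma form_expansion:
  assumes "orthonormal_basis UNIV fs" "\<alpha> \<in> forms_on UNIV"
  shows "\<alpha> vs = (\<Sum>K\<in>Pow {..<length fs}. \<alpha> (nths fs K) * bform (nths fs K) vs)"
proof -
  have "\<alpha> = (\<lambda>vs. \<Sum>K\<in>Pow {..<length fs}. \<alpha> (nths fs K) * bform (nths fs K) vs)"
    using assms orthogonal_spanning_zero[of "set fs"] contract_linear(4)[OF assms(2)]
    by (intro form_expansion_supported) (auto simp: orthonormal_basis_iff)
  then show ?thesis by (rule fun_cong)
qed

lemma orthonormal_basis_length: "orthonormal_basis L fs \<Longrightarrow> length fs = dim L"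
proof -
  assume a: "orthonormal_basis L fs"
  then have "independent (set fs)"
    by (intro pairwise_orthogonal_independent) (auto simp: orthonormal_basis_def)
  then show ?thesis
    using a dim_span_eq_card_independent[of "set fs"]
    by (auto simp: orthonormal_basis_def distinct_card)
qed

lemma ex_orthonormal_basis:
  fixes L :: "'a::euclidean_space set"
  assumes "subspace L"
  obtains fs where "orthonormal_basis L fs"
proof -
  obtain S where S: "S \<subseteq> L" "pairwise orthogonal S" "\<And>x. x \<in> S \<Longrightarrow> norm x = 1"
    "independent S" "card S = dim L" "span S = L"
    using orthonormal_basis_subspace[OF assms] by metis
  then obtain fs where "set fs = S" "distinct fs"
    using finite_distinct_list independent_bound by metis
  then show ?thesis
    using S that[of fs] by (auto simp: orthonormal_basis_def)
qed

text \<open>Every term of the expansion in an orthonormal frame has degree at most the dimension.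
  This justifies the cut-off in \<open>exp_form\<close>.\<close>

lemma form_degree_bound:
  fixes \<alpha> :: "'a::euclidean_space form"
  assumes "\<alpha> \<in> forms_on UNIV" "DIM('a) < length vs"
  shows "\<alpha> vs = 0"
proof -
  obtain fs :: "'a list" where fs: "orthonormal_basis UNIV fs"
    using ex_orthonormal_basis[OF subspace_UNIV] .
  have "length (nths fs K) \<le> DIM('a)" for K
    using orthonormal_basis_length[OF fs] length_nths[of fs K] card_mono[of "{..<length fs}" "{i. i < length fs \<and> i \<in> K}"]
    by auto
  then have "bform (nths fs K) vs = 0" for K
    using assms(2) by (intro bform_length) (metis not_less)
  then show ?thesis
    by (subst form_expansion[OF fs assms(1)]) simp
qed

section \<open>The inner product of forms in a frame, and adjointness of wedging and
  contraction\<close>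

definition frame_inner :: "'a list \<Rightarrow> 'a form \<Rightarrow> 'a form \<Rightarrow> real" where
  "frame_inner es \<alpha> \<beta> = (\<Sum>K\<in>Pow {..<length es}. \<alpha> (nths es K) * \<beta> (nths es K))"

lemma form_norm_eq: "form_norm es \<alpha> = sqrt (frame_inner es \<alpha> \<alpha>)"
  by (simp add: form_norm_def frame_inner_def power2_eq_square)

lemma frame_inner_Nil [simp]: "frame_inner [] \<alpha> \<beta> = \<alpha> [] * \<beta> []"
  by (simp add: frame_inner_def)

lemma frame_inner_Cons:
  "frame_inner (e # es) \<alpha> \<beta> =
    frame_inner es \<alpha> \<beta> + frame_inner es (contract e \<alpha>) (contract e \<beta>)"
  by (simp add: frame_inner_def sum_Pow_lessThan_Suc contract_def)

lemma frame_inner_commute: "frame_inner es \<alpha> \<beta> = frame_inner es \<beta> \<alpha>"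
  by (simp add: frame_inner_def mult.commute)

lemma frame_inner_linear:
  "frame_inner es (\<lambda>vs. \<alpha> vs + \<alpha>' vs) \<beta> = frame_inner es \<alpha> \<beta> + frame_inner es \<alpha>' \<beta>"
  "frame_inner es \<beta> (\<lambda>vs. \<alpha> vs + \<alpha>' vs) = frame_inner es \<beta> \<alpha> + frame_inner es \<beta> \<alpha>'"
  "frame_inner es (\<lambda>vs. \<alpha> vs - \<alpha>' vs) \<beta> = frame_inner es \<alpha> \<beta> - frame_inner es \<alpha>' \<beta>"
  "frame_inner es \<beta> (\<lambda>vs. \<alpha> vs - \<alpha>' vs) = frame_inner es \<beta> \<alpha> - frame_inner es \<beta> \<alpha>'"
  "frame_inner es (\<lambda>vs. c * \<alpha> vs) \<beta> = c * frame_inner es \<alpha> \<beta>"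
  "frame_inner es \<beta> (\<lambda>vs. c * \<alpha> vs) = c * frame_inner es \<beta> \<alpha>"
  "frame_inner es (\<lambda>vs. - \<alpha> vs) \<beta> = - frame_inner es \<alpha> \<beta>"
  "frame_inner es \<beta> (\<lambda>vs. - \<alpha> vs) = - frame_inner es \<beta> \<alpha>"
  "frame_inner es (\<lambda>vs. 0) \<beta> = 0"
  "frame_inner es \<beta> (\<lambda>vs. 0) = 0"
  by (simp_all add: frame_inner_def algebra_simps sum.distrib sum_subtractf sum_distrib_left sum_negf)

definition frame_proj :: "'a::euclidean_space list \<Rightarrow> 'a \<Rightarrow> 'a" where
  "frame_proj es v = (\<Sum>e\<leftarrow>es. (v \<bullet> e) *\<^sub>R e)"

lemma frame_proj_simps [simp]:
  "frame_proj [] v = 0" "frame_proj (e # es) v = (v \<bullet> e) *\<^sub>R e + frame_proj es v"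
  by (simp_all add: frame_proj_def)

lemma frame_proj_orthogonal: "(\<And>f. f \<in> set fs \<Longrightarrow> w \<bullet> f = 0) \<Longrightarrow> w \<bullet> frame_proj fs v = 0"
  by (induction fs) (auto simp: inner_add_right)

lemma frame_proj_inner: "orthonormal_list fs \<Longrightarrow> f \<in> set fs \<Longrightarrow> frame_proj fs v \<bullet> f = v \<bullet> f"
  by (induction fs)
    (auto simp: inner_add_left inner_add_right inner_commute frame_proj_orthogonal
      inner_commute[of "frame_proj _ _"])

lemma frame_proj_basis:
  assumes "orthonormal_basis UNIV fs"
  shows "frame_proj fs v = v"
proof -
  have "v - frame_proj fs v = 0"
    using assms by (intro orthogonal_spanning_zero[of "set fs"])
      (auto simp: orthonormal_basis_iff inner_diff_left frame_proj_inner)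
  then show ?thesis by simp
qed

text \<open>A partial frame sees only the component of \<open>v\<close> along it. The projection is
  what lets the induction on \<open>es\<close> go through.\<close>

lemma frame_inner_wedge_flat_proj:
  assumes "\<beta> \<in> forms_on UNIV"
  shows "frame_inner es (wedge (flat v) \<alpha>) \<beta> = frame_inner es \<alpha> (contract (frame_proj es v) \<beta>)"
  using assms
proof (induction es arbitrary: \<alpha> \<beta>)
  case Nil
  then show ?case by (simp add: contract_linear flat_def)
next
  case (Cons e es)
  have "contract e (contract (frame_proj es v) \<beta>) = (\<lambda>vs. - contract (frame_proj es v) (contract e \<beta>) vs)"
    using contract_swap[OF Cons.prems] .
  then show ?case
    using Cons by (simp add: frame_inner_Cons contract_wedge_flat frame_inner_linear forms_contract
        contract_linear contract_same)
qed

lemma frame_inner_wedge_flat: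
  assumes "orthonormal_basis UNIV es" "\<beta> \<in> forms_on UNIV"
  shows "frame_inner es (wedge (flat v) \<alpha>) \<beta> = frame_inner es \<alpha> (contract v \<beta>)"
  using frame_inner_wedge_flat_proj[OF assms(2)] frame_proj_basis[OF assms(1)] by simp

lemma frame_inner_bform:
  assumes "orthonormal_basis UNIV es" "\<beta> \<in> forms_on UNIV"
  shows "frame_inner es (bform us) \<beta> = \<beta> us"
  using assms(2)
proof (induction us arbitrary: \<beta>)
  case Nil
  have "frame_inner es one_form \<beta> = \<beta> []" for \<beta>
    by (induction es arbitrary: \<beta>) (simp_all add: frame_inner_Cons frame_inner_linear)
  then show ?case by simp
next
  case (Cons u us)
  then show ?case
    by (simp add: frame_inner_wedge_flat[OF assms(1)] forms_contract) (simp add: contract_def)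
qed

text \<open>The Gram determinant of the two lists; its symmetry comes from that of the inner product
  of forms.\<close>

lemma bform_commute: "bform us vs = bform vs us"
proof -
  obtain fs :: "'a list" where "orthonormal_basis UNIV fs"
    using ex_orthonormal_basis[OF subspace_UNIV] .
  then show ?thesis
    using frame_inner_bform[of fs "bform us" vs] frame_inner_bform[of fs "bform vs" us]
      frame_inner_commute[of fs "bform us"] by (simp add: forms_bform)
qed

lemma hodge_eq: "hodge es \<alpha> us = wedge \<alpha> (bform us) es"
  by (simp add: hodge_def wedge_def basis_form_eq bform_commute[of us] mult_ac)

section \<open>Exponentials of two-forms\<close>

lemma wedge_cong:
  assumes "\<And>us. set us \<subseteq> set vs \<Longrightarrow> length us \<le> length vs \<Longrightarrow> \<alpha> us = \<alpha>' us"
    and "\<And>us. set us \<subseteq> set vs \<Longrightarrow> length us \<le> length vs \<Longrightarrow> \<beta> us = \<beta>' us"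
  shows "wedge \<alpha> \<beta> vs = wedge \<alpha>' \<beta>' vs"
proof -
  have "length (nths vs I) \<le> length vs" for I
    using card_mono[of "{..<length vs}" "{i. i < length vs \<and> i \<in> I}"] by (auto simp: length_nths)
  then have "\<alpha> (nths vs I) = \<alpha>' (nths vs I)" "\<beta> (nths vs I) = \<beta>' (nths vs I)" for I
    using assms set_nths_subset[of vs I] by auto
  then show ?thesis by (simp add: wedge_def)
qed

lemma p_forms_forms: "\<alpha> \<in> p_forms_on UNIV p \<Longrightarrow> \<alpha> \<in> forms_on UNIV"
  by (simp add: p_forms_UNIV_iff)

lemma p_forms_scale: "\<alpha> \<in> p_forms_on UNIV p \<Longrightarrow> (\<lambda>vs. c * \<alpha> vs) \<in> p_forms_on UNIV p"
  and p_forms_minus: "\<alpha> \<in> p_forms_on UNIV p \<Longrightarrow> (\<lambda>vs. - \<alpha> vs) \<in> p_forms_on UNIV p"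
  and p_forms_add: "\<alpha> \<in> p_forms_on UNIV p \<Longrightarrow> \<beta> \<in> p_forms_on UNIV p \<Longrightarrow>
      (\<lambda>vs. \<alpha> vs + \<beta> vs) \<in> p_forms_on UNIV p"
  and p_forms_diff: "\<alpha> \<in> p_forms_on UNIV p \<Longrightarrow> \<beta> \<in> p_forms_on UNIV p \<Longrightarrow>
      (\<lambda>vs. \<alpha> vs - \<beta> vs) \<in> p_forms_on UNIV p"
  by (simp_all add: p_forms_UNIV_iff forms_scale forms_minus forms_add forms_diff)

lemma two_form_even: "C \<in> p_forms_on UNIV 2 \<Longrightarrow> involute C = C"
  by (simp add: p_forms_involute)

lemma contract_two_form:
  assumes "C \<in> p_forms_on UNIV 2"
  shows "involute (contract v C) = (\<lambda>vs. - contract v C vs)"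
    and "hat (contract v C) = (\<lambda>vs. - contract v C vs)"
proof -
  have e: "C (v # vs) = 0 \<or> length vs = 1" for vs
    using assms by (auto simp: p_forms_UNIV_iff)
  have "(-1) ^ length vs * C (v # vs) = - C (v # vs)"
    "(-1) ^ (length vs * (length vs + 1) div 2) * C (v # vs) = - C (v # vs)" for vs
    using e[of vs] by auto
  then show "involute (contract v C) = (\<lambda>vs. - contract v C vs)"
    "hat (contract v C) = (\<lambda>vs. - contract v C vs)"
    by (simp_all only: contract_def involute_def hat_def)
qed

lemma wedge_power_degree: "C \<in> p_forms_on UNIV 2 \<Longrightarrow> (wedge C ^^ j) one_form \<in> p_forms_on UNIV (2 * j)"
proof (induction j)
  case (Suc j)
  then show ?case using p_forms_wedge[of C 2 _ "2 * j"] by simp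
qed (simp add: p_forms_one)

text \<open>The power rule for a derivation: the even form \<open>C\<close> moves past
  \<open>contract v C\<close>.\<close>

lemma contract_wedge_power:
  assumes "C \<in> p_forms_on UNIV 2"
  shows "contract v ((wedge C ^^ Suc j) one_form) =
    (\<lambda>vs. real (Suc j) * wedge (contract v C) ((wedge C ^^ j) one_form) vs)"
proof (induction j)
  case 0
  show ?case by simp
next
  case (Suc j)
  have e: "wedge C (wedge (contract v C) X) = wedge (contract v C) (wedge C X)" for X
    using wedge_commute_even[OF two_form_even[OF assms]] by (metis wedge_assoc)
  have "contract v ((wedge C ^^ Suc (Suc j)) one_form) =
      (\<lambda>vs. wedge (contract v C) ((wedge C ^^ Suc j) one_form) vs +
        wedge C (contract v ((wedge C ^^ Suc j) one_form)) vs)"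
    by (simp add: contract_wedge two_form_even[OF assms])
  also have "\<dots> = (\<lambda>vs. real (Suc (Suc j)) * wedge (contract v C) ((wedge C ^^ Suc j) one_form) vs)"
    unfolding Suc.IH by (simp add: fun_eq_iff wedge_linear e algebra_simps)
  finally show ?case .
qed

lemma exp_form_Nil:
  fixes C :: "'a::euclidean_space form"
  assumes "C \<in> p_forms_on UNIV 2"
  shows "exp_form C [] = 1"
proof -
  have "(wedge C ^^ j) one_form [] = of_bool (j = 0)" for j
    using assms by (cases j) (auto simp: p_forms_UNIV_iff)
  then have "exp_form C [] = (\<Sum>j\<le>DIM('a). if j = 0 then 1 else 0)"
    unfolding exp_form_def by (intro sum.cong) simp_all
  then show ?thesis by simp
qed

lemma contract_exp_form:
  fixes C :: "'a::euclidean_space form"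
  assumes C: "C \<in> p_forms_on UNIV 2"
  shows "contract v (exp_form C) = wedge (contract v C) (exp_form C)"
proof
  fix vs
  obtain n where n: "DIM('a) = Suc n"
    using DIM_positive[where 'a='a] by (cases "DIM('a)") auto
  let ?P = "\<lambda>j. (wedge C ^^ j) one_form"
  \<comment> \<open>Contraction shifts the index, so the resulting sum ends one term early. The
    missing term is zero, since its degree is twice the dimension.\<close>
  have top: "?P (Suc n) = (\<lambda>vs. 0)"
  proof
    fix us
    have "?P (Suc n) \<in> p_forms_on UNIV (2 * Suc n)" by (rule wedge_power_degree[OF C])
    then show "?P (Suc n) us = 0"
      using form_degree_bound[of "?P (Suc n)" us] n
      by (cases "length us = 2 * Suc n") (simp_all add: p_forms_UNIV_iff del: funpow.simps)
  qed
  have "contract v (exp_form C) vs = (\<Sum>j\<le>Suc n. contract v (?P j) vs / fact j)"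
    by (simp add: exp_form_def n contract_def)
  also have "\<dots> = (\<Sum>j\<le>n. contract v (?P (Suc j)) vs / fact (Suc j))"
    by (subst sum.atMost_Suc_shift) simp
  also have "\<dots> = (\<Sum>j\<le>n. wedge (contract v C) (?P j) vs / fact j)"
    unfolding contract_wedge_power[OF C] by (simp add: divide_simps)
  also have "\<dots> = (\<Sum>j\<le>Suc n. wedge (contract v C) (?P j) vs / fact j)"
    by (subst sum.atMost_Suc) (simp_all only: top wedge_zero div_0 add_0_right)
  also have "\<dots> = wedge (contract v C) (exp_form C) vs"
    by (simp add: exp_form_def[abs_def] n wedge_sum_right divide_inverse mult.commute[of _ "inverse _"]
        wedge_scale_right del: sum.atMost_Suc)
  finally show "contract v (exp_form C) vs = wedge (contract v C) (exp_form C) vs" .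
qed

lemma forms_exp: "C \<in> p_forms_on UNIV 2 \<Longrightarrow> exp_form C \<in> forms_on UNIV"
  unfolding exp_form_def divide_inverse mult.commute[of _ "inverse _"]
  by (intro forms_sum forms_scale) (blast intro: p_forms_forms wedge_power_degree)

lemma involute_exp:
  assumes "C \<in> p_forms_on UNIV 2"
  shows "involute (exp_form C) = exp_form C"
proof
  fix vs
  have "(-1) ^ length vs * (wedge C ^^ j) one_form vs = (wedge C ^^ j) one_form vs" for j
    using p_forms_involute[OF wedge_power_degree[OF assms, of j]]
    by (simp add: involute_def fun_eq_iff)
  then show "involute (exp_form C) vs = exp_form C vs"
    unfolding involute_def exp_form_def sum_distrib_left times_divide_eq_right by (simp only:)
qed

text \<open>The differential equation \<open>\<iota>\<^sub>v X = \<iota>\<^sub>v C \<and> X\<close> determines the values of \<open>X\<close> on long lists from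
  those on shorter ones.\<close>

lemma exp_form_unique:
  assumes "C \<in> p_forms_on UNIV 2" "X [] = 1" "\<And>v. contract v X = wedge (contract v C) X"
  shows "X = exp_form C"
proof
  fix vs show "X vs = exp_form C vs"
  proof (induction vs rule: length_induct)
    case (1 vs)
    show ?case
    proof (cases vs)
      case Nil
      then show ?thesis by (simp add: assms exp_form_Nil)
    next
      case (Cons v us)
      have "X vs = wedge (contract v C) X us"
        using fun_cong[OF assms(3)[of v], of us] by (simp add: contract_def Cons)
      also have "\<dots> = wedge (contract v C) (exp_form C) us"
        by (rule wedge_cong) (use 1 Cons in auto)
      also have "\<dots> = exp_form C vs"
        using fun_cong[OF contract_exp_form[OF assms(1), of v], of us] by (simp add: contract_def Cons)
      finally show ?thesis .
    qed
  qed
qed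

text \<open>The product solves the contraction equation of the sum; uniqueness takes the place of a
  binomial expansion.\<close>

lemma exp_form_add:
  assumes "C \<in> p_forms_on UNIV 2" "D \<in> p_forms_on UNIV 2"
  shows "wedge (exp_form C) (exp_form D) = exp_form (\<lambda>vs. C vs + D vs)"
proof (rule exp_form_unique)
  show "(\<lambda>vs. C vs + D vs) \<in> p_forms_on UNIV 2" using assms by (rule p_forms_add)
  show "wedge (exp_form C) (exp_form D) [] = 1" by (simp add: exp_form_Nil assms)
  have "wedge (exp_form C) (wedge (contract v D) X) = wedge (contract v D) (wedge (exp_form C) X)" for v X
    using wedge_commute_even[OF involute_exp[OF assms(1)]] by (metis wedge_assoc)
  then show "contract v (wedge (exp_form C) (exp_form D)) =
      wedge (contract v (\<lambda>vs. C vs + D vs)) (wedge (exp_form C) (exp_form D))" for v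
    by (simp add: fun_eq_iff contract_wedge contract_exp_form assms involute_exp wedge_linear wedge_assoc)
qed

lemma exp_form_zero: "exp_form (\<lambda>vs::'a::euclidean_space list. 0) = one_form"
  by (rule exp_form_unique[symmetric]) (simp_all add: p_forms_UNIV_iff forms_zero)

lemma p_forms_flat_flat: "wedge (flat u) (flat v) \<in> p_forms_on UNIV 2"
  using p_forms_wedge[OF p_forms_flat p_forms_flat, of u v] by (simp add: numeral_2_eq_2)

text \<open>A decomposable two-form has square zero, so the exponential stops after the linear term.
  This is the source of the Clifford factors \<open>1 + c u v\<close>.\<close>

lemma exp_form_simple:
  "exp_form (\<lambda>vs. c * wedge (flat u) (flat v) vs) = (\<lambda>vs. one_form vs + c * wedge (flat u) (flat v) vs)"
proof (rule exp_form_unique[symmetric])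
  show "(\<lambda>vs. c * wedge (flat u) (flat v) vs) \<in> p_forms_on UNIV 2"
    by (intro p_forms_scale p_forms_flat_flat)
  show "one_form [] + c * wedge (flat u) (flat v) [] = 1" by (simp add: flat_def)
  have "wedge (flat u) (wedge (flat u) (flat v)) = (\<lambda>vs. 0)"
    by (simp add: wedge_flat_flat flip: wedge_assoc)
  moreover have "wedge (flat v) (wedge (flat u) (flat v)) = (\<lambda>vs. 0)"
    using wedge_flat_swap[of v u "flat v"] by (simp add: wedge_flat_flat)
  ultimately show "contract w (\<lambda>vs. one_form vs + c * wedge (flat u) (flat v) vs) =
      wedge (contract w (\<lambda>vs. c * wedge (flat u) (flat v) vs))
        (\<lambda>vs. one_form vs + c * wedge (flat u) (flat v) vs)" for w
    by (simp add: fun_eq_iff contract_wedge_flat wedge_linear)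
qed

text \<open>Each power of \<open>C\<close> beyond the zeroth has a factor \<open>C\<close> that can
  be moved next to \<open>\<gamma>\<close>.\<close>

lemma wedge_exp_form_absorb:
  assumes C: "C \<in> p_forms_on UNIV 2" and z: "wedge C \<gamma> = (\<lambda>vs. 0)"
  shows "wedge (exp_form C) \<gamma> = \<gamma>"
proof
  fix vs
  have s: "wedge ((wedge C ^^ j) one_form) \<gamma> = (if j = 0 then \<gamma> else (\<lambda>vs. 0))" for j
  proof (cases j)
    case (Suc i)
    have "wedge ((wedge C ^^ j) one_form) \<gamma> = wedge (wedge C ((wedge C ^^ i) one_form)) \<gamma>"
      by (simp add: Suc)
    also have "\<dots> = wedge ((wedge C ^^ i) one_form) (wedge C \<gamma>)"
      using wedge_commute_even[OF two_form_even[OF C]] by (metis wedge_assoc)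
    finally show ?thesis by (simp add: z Suc)
  qed simp
  have "wedge (exp_form C) \<gamma> vs = (\<Sum>j\<le>DIM('a). wedge ((wedge C ^^ j) one_form) \<gamma> vs / fact j)"
    by (simp add: exp_form_def[abs_def] wedge_sum_left divide_inverse mult.commute[of _ "inverse _"]
        wedge_scale_left)
  also have "\<dots> = (\<Sum>j\<le>DIM('a). if j = 0 then \<gamma> vs else 0)"
    by (rule sum.cong) (auto simp: s)
  finally show "wedge (exp_form C) \<gamma> vs = \<gamma> vs" by simp
qed

text \<open>\<open>hat\<close> is minus the identity on two-forms, and although it reverses
  products, even forms commute; so it solves the contraction equation with the opposite
  sign.\<close>

lemma hat_exp_form:
  assumes "C \<in> p_forms_on UNIV 2"
  shows "hat (exp_form (\<lambda>vs. - C vs)) = exp_form C"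
proof (rule exp_form_unique[OF assms])
  have m: "(\<lambda>vs. - C vs) \<in> p_forms_on UNIV 2" by (rule p_forms_minus[OF assms])
  let ?E = "exp_form (\<lambda>vs. - C vs)"
  show "hat ?E [] = 1" by (simp add: exp_form_Nil m)
  have e: "involute (hat ?E) = hat ?E"
    by (simp add: involute_exp m flip: hat_involute)
  show "contract v (hat ?E) = wedge (contract v C) (hat ?E)" for v
    using wedge_commute_even[OF e, of "contract v C"]
    by (simp add: contract_hat contract_exp_form[OF m] hat_wedge involute_wedge e
        contract_two_form[OF assms] fun_eq_iff wedge_linear)
qed

section \<open>Projections and Hodge duals of subspaces\<close>

lemma frame_proj_append: "frame_proj (us @ vs) x = frame_proj us x + frame_proj vs x"
  by (induction us) (simp_all add: add_ac)

lemma linear_frame_proj: "linear (frame_proj fs)"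
  by (rule linearI; induction fs) (simp_all add: inner_add_left algebra_simps)

lemma frame_proj_in_span: "frame_proj fs x \<in> span (set fs)"
proof (induction fs)
  case (Cons f fs)
  have "frame_proj fs x \<in> span (set (f # fs))"
    using Cons span_mono[of "set fs" "set (f # fs)"] by auto
  then show ?case by (simp add: span_add span_scale span_base)
qed (simp add: span_zero)

lemma frame_proj_residue:
  assumes "orthonormal_list fs" "z \<in> span (set fs)"
  shows "(x - frame_proj fs x) \<bullet> z = 0"
proof -
  have "orthogonal (x - frame_proj fs x) z"
    using assms by (intro orthogonal_to_span[of z "set fs"])
      (auto simp: orthogonal_def inner_diff_left frame_proj_inner)
  then show ?thesis by (simp add: orthogonal_def)
qed

lemma orth_proj_eq:
  assumes "orthonormal_basis L ls"
  shows "orth_proj L = frame_proj ls"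
proof
  fix x
  have L: "L = span (set ls)" and o: "orthonormal_list ls"
    using assms by (auto simp: orthonormal_basis_iff)
  show "orth_proj L x = frame_proj ls x"
    unfolding orth_proj_def
  proof (rule the_equality)
    show "frame_proj ls x \<in> L \<and> (\<forall>z\<in>L. (x - frame_proj ls x) \<bullet> z = 0)"
      by (auto simp: L frame_proj_in_span frame_proj_residue o)
    fix y assume y: "y \<in> L \<and> (\<forall>z\<in>L. (x - y) \<bullet> z = 0)"
    let ?z = "y - frame_proj ls x"
    have z: "?z \<in> L" using y by (auto simp: L intro: span_diff frame_proj_in_span)
    have "?z \<bullet> ?z = (x - frame_proj ls x) \<bullet> ?z - (x - y) \<bullet> ?z"
      by (simp add: inner_diff_left)
    also have "\<dots> = 0" using y z by (simp add: frame_proj_residue o L)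
    finally show "y = frame_proj ls x" by simp
  qed
qed

lemma frame_proj_orthogonal_eq_0: "(\<And>f. f \<in> set fs \<Longrightarrow> w \<bullet> f = 0) \<Longrightarrow> frame_proj fs w = 0"
  by (induction fs) auto

lemma frame_proj_span:
  assumes "orthonormal_list fs" "x \<in> span (set fs)"
  shows "frame_proj fs x = x"
proof -
  have "(x - frame_proj fs x) \<bullet> (x - frame_proj fs x) = 0"
    using assms by (intro frame_proj_residue) (auto intro: span_diff frame_proj_in_span)
  then show ?thesis by simp
qed

lemma p_forms_pull_back:
  assumes F: "F \<in> p_forms_on L p" and f: "linear f" "range f \<subseteq> L"
  shows "pull_back f F \<in> p_forms_on UNIV p"
proof -
  have L: "f x \<in> L" "set (map f xs) \<subseteq> L" for x xs using f(2) by auto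
  have F': "F \<in> forms_on L" using F by (simp add: p_forms_on_def)
  have "pull_back f F \<in> forms_on UNIV"
  proof (rule forms_UNIV_I)
    fix us v vs
    have "F (map f us @ (f a + f b) # map f vs) = F (map f us @ f a # map f vs) + F (map f us @ f b # map f vs)"
      "F (map f us @ (c *\<^sub>R f a) # map f vs) = c * F (map f us @ f a # map f vs)" for a b c
      using F' L(1) L(2)[of "us @ vs"] unfolding forms_on_def by simp_all
    then show "linear (\<lambda>v. pull_back f F (us @ v # vs))"
      by (intro linearI) (simp_all add: pull_back_def linear_add[OF f(1)] linear_scale[OF f(1)])
    have "\<not> distinct (map f (us @ v # v # vs))" by simp
    then show "pull_back f F (us @ v # v # vs) = 0"
      using F' unfolding forms_on_def pull_back_def by blast
  qed
  then show ?thesis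
    using F by (simp add: p_forms_UNIV_iff p_forms_on_def pull_back_def)
qed

text \<open>The third assumption confines the form to the span of \<open>fs\<close>; vanishing in
  lower degrees then leaves only the full product.\<close>

lemma form_expansion_top:
  assumes "orthonormal_list fs" "\<alpha> \<in> forms_on UNIV"
    and "\<And>w. (\<And>f. f \<in> set fs \<Longrightarrow> w \<bullet> f = 0) \<Longrightarrow> contract w \<alpha> = (\<lambda>vs. 0)"
    and "\<And>vs. length vs < length fs \<Longrightarrow> \<alpha> vs = 0"
  shows "\<alpha> = (\<lambda>vs. \<alpha> fs * bform fs vs)"
proof
  fix vs
  have "\<alpha> vs = (\<Sum>K\<in>Pow {..<length fs}. \<alpha> (nths fs K) * bform (nths fs K) vs)"
    by (rule fun_cong[OF form_expansion_supported[OF assms(1-3)]])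
  also have "\<dots> = (\<Sum>K\<in>Pow {..<length fs}. if K = {..<length fs} then \<alpha> fs * bform fs vs else 0)"
  proof (rule sum.cong)
    fix K assume K: "K \<in> Pow {..<length fs}"
    then have "length (nths fs K) < length fs" if "K \<noteq> {..<length fs}"
      using that psubset_card_mono[of "{..<length fs}" K] by (simp add: length_nths_subset psubset_eq)
    then show "\<alpha> (nths fs K) * bform (nths fs K) vs =
        (if K = {..<length fs} then \<alpha> fs * bform fs vs else 0)"
      using assms(4) by auto
  qed simp
  also have "\<dots> = \<alpha> fs * bform fs vs" by simp
  finally show "\<alpha> vs = \<alpha> fs * bform fs vs" .
qed

text \<open>This is the change-of-basis determinant. Were it zero, all coefficients of
  \<open>bform fs\<close> in \<open>es\<close> would vanish, while its squared norm is 1.\<close>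

lemma bform_basis_nonzero:
  assumes "orthonormal_basis UNIV es" "orthonormal_basis UNIV fs"
  shows "bform fs es \<noteq> 0"
proof
  assume z: "bform fs es = 0"
  have o: "orthonormal_list fs" "orthonormal_list es" and l: "length es = length fs"
    using assms orthonormal_basis_length[OF assms(1)] orthonormal_basis_length[OF assms(2)]
    by (auto simp: orthonormal_basis_iff)
  have n: "length (nths es K) \<noteq> length fs" if "K \<subseteq> {..<length es}" "K \<noteq> {..<length es}" for K
    using that psubset_card_mono[of "{..<length es}" K]
    by (simp add: length_nths_subset psubset_eq flip: l)
  have "bform fs (nths es K) = 0" if "K \<subseteq> {..<length es}" for K
    using z n[OF that] by (cases "K = {..<length es}") (auto simp: bform_length)
  then have "frame_inner es (bform fs) (bform fs) = 0"
    by (auto simp: frame_inner_def intro!: sum.neutral)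
  moreover have "frame_inner es (bform fs) (bform fs) = 1"
    using bform_nths_nths[of fs "{..<length fs}" "{..<length fs}"] o
    by (simp add: frame_inner_bform assms forms_bform)
  ultimately show False by simp
qed

text \<open>Up to the orientation \<open>\<omega> ls\<close> and the change-of-basis determinant,
  the dual of the volume form of \<open>L\<close> is the volume form of the normal space.\<close>

lemma hodge_pull_back:
  assumes es: "orthonormal_basis UNIV es" and ls: "orthonormal_basis L ls"
    and fs: "orthonormal_basis UNIV (ls @ ns)" and \<omega>: "\<omega> \<in> p_forms_on L (length ls)"
  shows "hodge es (pull_back (orth_proj L) \<omega>) = (\<lambda>vs. \<omega> ls * bform (ls @ ns) es * bform ns vs)"
proof -
  have ol: "orthonormal_list ls" and on: "orthonormal_list ns" and L: "L = span (set ls)"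
    and orth: "\<And>u v. u \<in> set ls \<Longrightarrow> v \<in> set ns \<Longrightarrow> u \<bullet> v = 0"
    using ls fs by (auto simp: orthonormal_basis_iff orthonormal_list_append)
  let ?p = "frame_proj ls"
  have p: "orth_proj L = ?p" by (rule orth_proj_eq[OF ls])
  have \<omega>': "pull_back ?p \<omega> \<in> p_forms_on UNIV (length ls)"
    by (rule p_forms_pull_back[OF \<omega> linear_frame_proj]) (auto simp: L frame_proj_in_span)
  have "pull_back ?p \<omega> = (\<lambda>vs. pull_back ?p \<omega> ls * bform ls vs)"
  proof (rule form_expansion_top[OF ol])
    show "pull_back ?p \<omega> \<in> forms_on UNIV" using \<omega>' by (rule p_forms_forms)
    show "pull_back ?p \<omega> vs = 0" if "length vs < length ls" for vs
      using \<omega>' that by (simp add: p_forms_UNIV_iff)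
    fix w assume "\<And>f. f \<in> set ls \<Longrightarrow> w \<bullet> f = 0"
    then have "?p w = 0" by (rule frame_proj_orthogonal_eq_0)
    then have "contract w (pull_back ?p \<omega>) = contract 0 (pull_back ?p \<omega>)"
      by (simp add: contract_def pull_back_def linear_0[OF linear_frame_proj])
    then show "contract w (pull_back ?p \<omega>) = (\<lambda>vs. 0)"
      using \<omega>' by (simp add: contract_linear p_forms_forms)
  qed
  moreover have "map ?p ls = ls"
    by (rule map_idI) (simp add: frame_proj_span ol span_base)
  ultimately have \<omega>ls: "pull_back ?p \<omega> = (\<lambda>vs. \<omega> ls * bform ls vs)"
    by (simp add: pull_back_def)
  \<comment> \<open>A form on the normal space: a vector orthogonal to \<open>ns\<close> lies in the
    span of \<open>ls\<close>, whose vectors already occur among the arguments.\<close>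
  let ?\<eta> = "\<lambda>us. bform es (ls @ us)"
  have l: "length es = length (ls @ ns)"
    using orthonormal_basis_length[OF es] orthonormal_basis_length[OF fs] by simp
  have "?\<eta> = (\<lambda>us. ?\<eta> ns * bform ns us)"
  proof (rule form_expansion_top[OF on])
    show "?\<eta> \<in> forms_on UNIV"
      using forms_linear[OF forms_bform, of es "ls @ _"] forms_adjacent[OF forms_bform, of es "ls @ _"]
      by (intro forms_UNIV_I) simp_all
    show "?\<eta> vs = 0" if "length vs < length ns" for vs
      using that l by (intro bform_length) simp
    fix w assume w: "\<And>f. f \<in> set ns \<Longrightarrow> w \<bullet> f = 0"
    have "w = ?p w"
      using frame_proj_basis[OF fs, of w] w by (simp add: frame_proj_append frame_proj_orthogonal_eq_0)
    then have sp: "w \<in> span (set ls)" using frame_proj_in_span[of ls w] by simp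
    have "bform es (ls @ u # us) = 0" if "u \<in> set ls" for u us
      using bform_not_distinct[of "ls @ u # us"] that bform_commute[of es] by simp
    then have "bform es (ls @ w # us) = 0" for us
      using linear_eq_0_on_span[OF forms_linear[OF forms_bform, of es ls us] _ sp] by blast
    then show "contract w ?\<eta> = (\<lambda>vs. 0)" by (simp add: contract_def)
  qed
  then have \<eta>: "bform (ls @ us) es = bform (ls @ ns) es * bform ns us" for us
    by (subst (1 2) bform_commute[of _ es]) (rule fun_cong)
  have "hodge es (pull_back ?p \<omega>) us = \<omega> ls * bform (ls @ us) es" for us
    unfolding hodge_eq \<omega>ls wedge_scale_left bform_append ..
  also have "\<omega> ls * bform (ls @ us) es = \<omega> ls * bform (ls @ ns) es * bform ns us" for us
    by (subst \<eta>) simp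
  finally show ?thesis
    unfolding p by (rule ext)
qed

section \<open>Maxima of linear functionals and the skew normal form\<close>

lemma linear_functional_on_span:
  fixes f :: "'a::euclidean_space \<Rightarrow> real"
  assumes "orthonormal_basis L ls" "linear f"
  obtains a where "a \<in> L" "\<And>x. x \<in> L \<Longrightarrow> f x = a \<bullet> x"
proof -
  define a where "a = (\<Sum>l\<leftarrow>ls. f l *\<^sub>R l)"
  have L: "L = span (set ls)" and o: "orthonormal_list ls"
    using assms by (auto simp: orthonormal_basis_iff)
  have "(\<Sum>l\<leftarrow>ks. f l *\<^sub>R l) \<in> span (set ls)" if "set ks \<subseteq> set ls" for ks
    using that by (induction ks) (auto intro: span_zero span_add span_scale span_base)
  then have "a \<in> L" by (simp add: a_def L)
  moreover have "f x = a \<bullet> x" if "x \<in> L" for x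
  proof -
    have e: "f (frame_proj ks x) = (\<Sum>l\<leftarrow>ks. f l *\<^sub>R l) \<bullet> x" for ks
      by (induction ks)
        (simp_all add: linear_0[OF assms(2)] linear_add[OF assms(2)] linear_scale[OF assms(2)]
          inner_add_left inner_commute[of x])
    then show ?thesis
      using e[of ls] frame_proj_span[OF o, of x] that unfolding L a_def by simp
  qed
  ultimately show ?thesis by (rule that)
qed

text \<open>On \<open>L\<close> the functional is the inner product with some \<open>a\<close>.
  Maximality at the unit vector \<open>v\<close> is equality in the Cauchy-Schwarz inequality, so
  \<open>a\<close> is a nonnegative multiple of \<open>v\<close>.\<close>

lemma linear_functional_maximal:
  fixes f :: "'a::euclidean_space \<Rightarrow> real"
  assumes "subspace L" "linear f" "v \<in> L" "norm v = 1"
    and max: "\<And>x. x \<in> L \<Longrightarrow> norm x = 1 \<Longrightarrow> f x \<le> f v" and "x \<in> L"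
  shows "f x = f v * (v \<bullet> x)"
proof -
  obtain ls where "orthonormal_basis L ls" using ex_orthonormal_basis[OF assms(1)] .
  then obtain a where a: "a \<in> L" "\<And>x. x \<in> L \<Longrightarrow> f x = a \<bullet> x"
    using linear_functional_on_span assms(2) by blast
  show ?thesis
  proof (cases "a = 0")
    case True
    then show ?thesis using a assms by simp
  next
    case False
    have "(1 / norm a) *\<^sub>R a \<in> L" using a assms(1) by (simp add: subspace_scale)
    then have "a \<bullet> ((1 / norm a) *\<^sub>R a) \<le> a \<bullet> v"
      using max[of "(1 / norm a) *\<^sub>R a"] a assms(3) False by simp
    then have "norm a \<le> a \<bullet> v"
      using False by (simp add: dot_square_norm power2_eq_square)
    then have e: "a \<bullet> v = norm a * norm v"
      using norm_cauchy_schwarz[of a v] assms(4) by simp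
    then have "a = norm a *\<^sub>R v"
      using norm_cauchy_schwarz_eq[of a v] assms(4) by simp
    then have "a \<bullet> x = (norm a *\<^sub>R v) \<bullet> x" by (rule arg_cong)
    then show ?thesis
      using a(2) assms(3,4,6) e by simp
  qed
qed

text \<open>A maximum of \<open>C\<close> over pairs of unit vectors spans a block of the normal form of \<open>C\<close>.\<close>

lemma two_form_block:
  fixes C :: "'a::euclidean_space form"
  assumes C: "C \<in> p_forms_on UNIV 2" and L: "subspace L"
    and nz: "x0 \<in> L" "y0 \<in> L" "C [x0, y0] \<noteq> 0"
  obtains u v c where "u \<in> L" "v \<in> L" "u \<bullet> u = 1" "v \<bullet> v = 1" "u \<bullet> v = 0"
    "\<And>x. x \<in> L \<Longrightarrow> C [u, x] = c * (v \<bullet> x)" "\<And>x. x \<in> L \<Longrightarrow> C [v, x] = - c * (u \<bullet> x)"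
proof -
  have F: "C \<in> forms_on UNIV" using C by (rule p_forms_forms)
  have l1: "linear (\<lambda>x. C [x, y])" and l2: "linear (\<lambda>y. C [x, y])" for x y
    using forms_linear[OF F, of "[]" "[y]"] forms_linear[OF F, of "[x]" "[]"] by simp_all
  have skew: "C [x, y] = - C [y, x]" for x y
    using fun_cong[OF contract_swap[OF F, of y x], of "[]"] by (simp add: contract_def)
  have "bounded_bilinear (\<lambda>x y. C [x, y])"
    unfolding bilinear_conv_bounded_bilinear[symmetric] bilinear_def using l1 l2 by blast
  note cont = bounded_bilinear.continuous_on[OF this continuous_on_fst[OF continuous_on_id]
      continuous_on_snd[OF continuous_on_id]]
  let ?K = "L \<inter> sphere 0 1"
  have K: "compact (?K \<times> ?K)"
    by (intro compact_Times closed_Int_compact closed_subspace L compact_sphere)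
  have "x0 \<noteq> 0" "y0 \<noteq> 0"
    using nz(3) linear_0[OF l1] linear_0[OF l2] by metis+
  then have "(1 / norm x0) *\<^sub>R x0 \<in> ?K" "(1 / norm y0) *\<^sub>R y0 \<in> ?K"
    using nz L by (auto simp: subspace_scale)
  then have "?K \<times> ?K \<noteq> {}" by blast
  from continuous_attains_sup[OF K this, of "\<lambda>p. C [fst p, snd p]"] cont
  obtain u v where uv: "u \<in> ?K" "v \<in> ?K" "\<And>x y. x \<in> ?K \<Longrightarrow> y \<in> ?K \<Longrightarrow> C [x, y] \<le> C [u, v]"
    by (auto simp: case_prod_beta)
  have 1: "C [u, x] = C [u, v] * (v \<bullet> x)" if "x \<in> L" for x
    by (rule linear_functional_maximal[OF L l2]) (use uv that in auto)
  have 2: "C [x, v] = C [u, v] * (u \<bullet> x)" if "x \<in> L" for x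
    by (rule linear_functional_maximal[OF L l1]) (use uv that in auto)
  have unit: "u \<bullet> u = 1" "v \<bullet> v = 1" using uv by (auto simp: norm_eq_1)
  \<comment> \<open>A maximum of zero would bound \<open>C [x0, y0]\<close> and, after a sign change
    of \<open>x0\<close>, its negative as well.\<close>
  have "C [u, v] \<noteq> 0"
  proof
    assume z: "C [u, v] = 0"
    have s: "(1 / norm x0) *\<^sub>R x0 \<in> ?K" "(1 / norm y0) *\<^sub>R y0 \<in> ?K" "- ((1 / norm x0) *\<^sub>R x0) \<in> ?K"
      using nz L \<open>x0 \<noteq> 0\<close> \<open>y0 \<noteq> 0\<close> by (auto simp: subspace_scale subspace_neg)
    have "C [(1 / norm x0) *\<^sub>R x0, (1 / norm y0) *\<^sub>R y0] \<le> 0"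
      "C [- ((1 / norm x0) *\<^sub>R x0), (1 / norm y0) *\<^sub>R y0] \<le> 0"
      using uv(3) s z by auto
    then have "C [x0, y0] = 0"
      using \<open>x0 \<noteq> 0\<close> \<open>y0 \<noteq> 0\<close>
      by (simp add: linear_scale[OF l1] linear_scale[OF l2] linear_neg[OF l1] zero_le_divide_iff
          divide_le_0_iff zero_le_mult_iff mult_le_0_iff)
    then show False using nz by simp
  qed
  \<comment> \<open>Evaluating the formula for \<open>C [u, x]\<close> at \<open>x = u\<close>
    forces \<open>u\<close> and \<open>v\<close> to be orthogonal.\<close>
  moreover have "C [u, u] = 0" using skew[of u u] by simp
  ultimately have "u \<bullet> v = 0" using 1[of u] uv(1) by (simp add: inner_commute)
  have 3: "C [v, x] = - C [u, v] * (u \<bullet> x)" if "x \<in> L" for x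
    using 2[OF that] skew[of v x] by simp
  show ?thesis
    by (rule that[OF _ _ unit \<open>u \<bullet> v = 0\<close> 1 3]) (use uv in auto)
qed

section \<open>Clifford action of forms\<close>

lemma scaleR_eq_scale: "r *\<^sub>R (x::complex ^ 'n) = of_real r *s x"
  unfolding vec_eq_iff vector_scaleR_component vector_smult_component
  by (simp add: scaleR_conv_of_real)

context spin_representation
begin

lemma linear_cl: "linear (cl v)"
  by (rule linearI) (simp_all add: cl_add cl_scale scaleR_eq_scale)

lemmas cl_spinor_simps = linear_0[OF linear_cl] linear_add[OF linear_cl] linear_diff[OF linear_cl]
  linear_neg[OF linear_cl] linear_scale[OF linear_cl]

lemmas cl_vector_simps = linear_0[OF cl_linear] linear_add[OF cl_linear] linear_scale[OF cl_linear]

lemma cl_anticommute: "cl u (cl v \<Psi>) = - cl v (cl u \<Psi>) - (2 * (u \<bullet> v)) *\<^sub>R \<Psi>"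
proof -
  let ?a = "(u \<bullet> u) *\<^sub>R \<Psi>" and ?b = "(v \<bullet> v) *\<^sub>R \<Psi>" and ?c = "(2 * (u \<bullet> v)) *\<^sub>R \<Psi>"
  have "(u + v) \<bullet> (u + v) = u \<bullet> u + v \<bullet> v + 2 * (u \<bullet> v)"
    by (simp add: inner_add_left inner_add_right inner_commute)
  then have "- (?a + ?b + ?c) = cl (u + v) (cl (u + v) \<Psi>)"
    by (simp only: cl_square scaleR_add_left)
  also have "\<dots> = - ?a + cl u (cl v \<Psi>) + cl v (cl u \<Psi>) - ?b"
    by (simp add: cl_vector_simps cl_add cl_square)
  finally have "cl u (cl v \<Psi>) + cl v (cl u \<Psi>) + ?c = - (?a + ?b + ?c) + (?a + ?b + ?c)"
    by simp
  then show ?thesis by (simp add: eq_diff_eq eq_neg_iff_add_eq_0 add_ac)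
qed

lemma cl_orthogonal: "u \<bullet> v = 0 \<Longrightarrow> cl u (cl v \<Psi>) = - cl v (cl u \<Psi>)"
  using cl_anticommute[of u v] by simp

lemma cl_unit: "v \<bullet> v = 1 \<Longrightarrow> cl v (cl v \<Psi>) = - \<Psi>"
  by (simp add: cl_square)

lemma act_Nil [simp]: "act [] cl \<alpha> \<Psi> = \<alpha> [] *\<^sub>R \<Psi>"
  by (simp add: act_def)

lemma act_Cons: "act (e # us) cl \<alpha> \<Psi> = act us cl \<alpha> \<Psi> + cl e (act us cl (contract e \<alpha>) \<Psi>)"
  by (simp add: act_def sum_Pow_lessThan_Suc contract_def linear_sum[OF linear_cl] linear_scale[OF linear_cl])

lemma act_linear:
  "act us cl (\<lambda>vs. \<alpha> vs + \<beta> vs) \<Psi> = act us cl \<alpha> \<Psi> + act us cl \<beta> \<Psi>"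
  "act us cl (\<lambda>vs. \<alpha> vs - \<beta> vs) \<Psi> = act us cl \<alpha> \<Psi> - act us cl \<beta> \<Psi>"
  "act us cl (\<lambda>vs. - \<alpha> vs) \<Psi> = - act us cl \<alpha> \<Psi>"
  "act us cl (\<lambda>vs. c * \<alpha> vs) \<Psi> = c *\<^sub>R act us cl \<alpha> \<Psi>"
  "act us cl (\<lambda>vs. 0) \<Psi> = 0"
  by (simp_all add: act_def algebra_simps sum.distrib sum_subtractf sum_negf scaleR_sum_right)

text \<open>Clifford multiplication by \<open>v\<close> is wedging minus contraction. As with
  \<open>frame_inner\<close>, a partial frame sees only the projection of \<open>v\<close>.\<close>

lemma act_wedge_flat_proj:
  assumes "orthonormal_list us" "\<alpha> \<in> forms_on UNIV"
  shows "act us cl (wedge (flat v) \<alpha>) \<Psi> =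
    cl (frame_proj us v) (act us cl \<alpha> \<Psi>) + act us cl (contract (frame_proj us v) \<alpha>) \<Psi>"
  using assms
proof (induction us arbitrary: \<alpha>)
  case Nil
  then show ?case by (simp add: contract_linear flat_def cl_vector_simps)
next
  case (Cons e us)
  let ?p = "frame_proj us v" and ?a = "act us cl \<alpha> \<Psi>" and ?b = "act us cl (contract e \<alpha>) \<Psi>"

  let ?c = "act us cl (contract ?p (contract e \<alpha>)) \<Psi>"
  have e: "e \<bullet> e = 1" and us: "orthonormal_list us" and o: "\<And>f. f \<in> set us \<Longrightarrow> e \<bullet> f = 0"
    using Cons.prems by auto
  have s: "contract e (contract ?p \<alpha>) = (\<lambda>vs. - contract ?p (contract e \<alpha>) vs)"
    by (rule contract_swap[OF Cons.prems(2)])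
  have "act (e # us) cl (wedge (flat v) \<alpha>) \<Psi> =
      cl ?p ?a + act us cl (contract ?p \<alpha>) \<Psi> + cl e ((v \<bullet> e) *\<^sub>R ?a - (cl ?p ?b + ?c))"
    by (simp add: act_Cons contract_wedge_flat act_linear Cons.IH us forms_contract Cons.prems(2))
  moreover have "cl e (cl ?p ?b) = - cl ?p (cl e ?b)"
    by (rule cl_orthogonal) (simp add: frame_proj_orthogonal o)
  ultimately show ?case
    by (simp add: act_Cons act_linear contract_linear forms_contract Cons.prems(2) s
        contract_same cl_vector_simps cl_spinor_simps cl_unit[OF e] algebra_simps)
qed

lemma orthonormal_frame: "orthonormal_list es"
  using frame by (simp add: orthonormal_basis_iff)

lemma act_wedge_flat:
  assumes "\<alpha> \<in> forms_on UNIV"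
  shows "act es cl (wedge (flat v) \<alpha>) \<Psi> = cl v (act es cl \<alpha> \<Psi>) + act es cl (contract v \<alpha>) \<Psi>"
  using act_wedge_flat_proj[OF orthonormal_frame assms] frame_proj_basis[OF frame] by simp

lemma act_one: "act es cl one_form \<Psi> = \<Psi>"
proof -
  have "act us cl one_form \<Psi> = \<Psi>" for us
    by (induction us) (simp_all add: act_Cons act_linear cl_spinor_simps)
  then show ?thesis .
qed

text \<open>When a vector is orthogonal to the rest, the contraction term drops out. The list need
  not consist of vectors of \<open>es\<close>, which admits bases adapted to
  \<open>L\<close>.\<close>

lemma act_bform:
  assumes "orthonormal_list us"
  shows "act es cl (bform us) \<Psi> = foldr cl us \<Psi>"
  using assms
  by (induction us)
    (simp_all add: act_one act_wedge_flat forms_bform contract_bform_orthogonal act_linear)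

section \<open>The Hermitian product and forms that act as scaled isometries\<close>

lemma q_left_add: "q (\<Phi> + \<Phi>') \<Psi> = q \<Phi> \<Psi> + q \<Phi>' \<Psi>"
  using q_hermitian q_add by (metis complex_cnj_add)

lemma q_left_scale: "q (c *s \<Phi>) \<Psi> = cnj c * q \<Phi> \<Psi>"
  using q_hermitian q_scale by (metis complex_cnj_mult)

lemma q_scaleR: "q \<Psi> (r *\<^sub>R \<Phi>) = of_real r * q \<Psi> \<Phi>" "q (r *\<^sub>R \<Phi>) \<Psi> = of_real r * q \<Phi> \<Psi>"
  by (simp_all add: scaleR_eq_scale q_scale q_left_scale)

lemma q_minus: "q \<Psi> (- \<Phi>) = - q \<Psi> \<Phi>" "q (- \<Phi>) \<Psi> = - q \<Phi> \<Psi>"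
  using q_scaleR[of _ "-1"] q_scaleR(2)[of "-1"] by simp_all

lemma q_zero: "q \<Psi> 0 = 0" "q 0 \<Psi> = 0"
  using q_scaleR[of _ 0] q_scaleR(2)[of 0] by simp_all

lemma q_diff: "q \<Psi> (\<Phi> - \<Phi>') = q \<Psi> \<Phi> - q \<Psi> \<Phi>'" "q (\<Phi> - \<Phi>') \<Psi> = q \<Phi> \<Psi> - q \<Phi>' \<Psi>"
  using q_add[of \<Psi> \<Phi> "- \<Phi>'"] q_left_add[of \<Phi> "- \<Phi>'" \<Psi>] by (simp_all add: q_minus)

lemma q_sum: "q \<Psi> (\<Sum>i\<in>S. f i) = (\<Sum>i\<in>S. q \<Psi> (f i))"
  by (induction S rule: infinite_finite_induct) (simp_all add: q_zero q_add)

lemma q_self: "q \<Psi> \<Psi> = of_real (Re (q \<Psi> \<Psi>))"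
  using q_hermitian[of \<Psi> \<Psi>] by (simp add: complex_eq_iff)

lemma q_cl: "q (cl v \<Psi>) \<Phi> = - q \<Psi> (cl v \<Phi>)"
proof -
  have "act es cl (flat v) \<Psi> = cl v \<Psi>" for \<Psi>
    using act_wedge_flat[OF forms_one, of v] by (simp add: act_one act_linear)
  then show ?thesis
    using q_adjoint[OF forms_flat[of v], of \<Psi> \<Phi>] by (simp add: act_linear q_minus)
qed

lemma q_cl_unit: "v \<bullet> v = 1 \<Longrightarrow> q (cl v \<Psi>) (cl v \<Phi>) = q \<Psi> \<Phi>"
  by (simp add: q_cl cl_unit q_minus)

lemma q_foldr_cl:
  "(\<And>v. v \<in> set us \<Longrightarrow> v \<bullet> v = 1) \<Longrightarrow> q (foldr cl us \<Psi>) (foldr cl us \<Phi>) = q \<Psi> \<Phi>"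
  by (induction us) (simp_all add: q_cl_unit)

text \<open>The scale factor is required to be the squared norm of the form itself: this is what
  yields the bound with the constant \<open>gen_norm\<close>. Positivity allows
  normalisation.\<close>

definition conformal :: "'a form \<Rightarrow> bool" where
  "conformal \<gamma> \<longleftrightarrow> \<gamma> \<in> forms_on UNIV \<and> 0 < frame_inner es \<gamma> \<gamma> \<and>
    (\<forall>\<Psi>. q (act es cl \<gamma> \<Psi>) (act es cl \<gamma> \<Psi>) = of_real (frame_inner es \<gamma> \<gamma>) * q \<Psi> \<Psi>)"

lemma conformal_one: "conformal one_form"
  using frame_inner_bform[OF frame forms_one, of "[]"]
  by (simp add: conformal_def forms_one act_one)

lemma conformal_scale: "conformal \<gamma> \<Longrightarrow> c \<noteq> 0 \<Longrightarrow> conformal (\<lambda>vs. c * \<gamma> vs)"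
  by (simp add: conformal_def forms_scale frame_inner_linear act_linear q_scaleR zero_less_mult_iff
      mult.assoc[symmetric]) (metis mult.assoc mult_pos_pos not_square_less_zero
      linorder_neqE_linordered_idom zero_less_mult_iff)

lemma conformal_wedge_flat:
  assumes "conformal \<gamma>" "u \<bullet> u = 1" "contract u \<gamma> = (\<lambda>vs. 0)"
  shows "conformal (wedge (flat u) \<gamma>)"
proof -
  have \<gamma>: "\<gamma> \<in> forms_on UNIV" using assms(1) by (simp add: conformal_def)
  have c: "contract u (wedge (flat u) \<gamma>) = \<gamma>"
    using assms by (simp add: contract_wedge_flat)
  have "frame_inner es (wedge (flat u) \<gamma>) (wedge (flat u) \<gamma>) = frame_inner es \<gamma> \<gamma>"
    by (simp add: frame_inner_wedge_flat[OF frame] forms_wedge forms_flat \<gamma> c)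
  then show ?thesis
    using assms by (simp add: conformal_def forms_wedge forms_flat act_wedge_flat act_linear q_cl_unit)
qed

lemma conformal_bform: "orthonormal_list us \<Longrightarrow> conformal (bform us)"
  by (induction us) (simp_all add: conformal_one conformal_wedge_flat contract_bform_orthogonal)

text \<open>The Clifford product \<open>u v\<close> is isometric and skew for \<open>q\<close>, so
  the mixed terms cancel and \<open>1 + c u v\<close> scales \<open>q\<close> by
  \<open>1 + c\<^sup>2\<close>. The squared norm of the form grows by the same factor.\<close>

lemma conformal_pair:
  assumes \<gamma>: "conformal \<gamma>" "contract u \<gamma> = (\<lambda>vs. 0)" "contract v \<gamma> = (\<lambda>vs. 0)"
    and uv: "u \<bullet> u = 1" "v \<bullet> v = 1" "u \<bullet> v = 0"
  shows "conformal (\<lambda>vs. \<gamma> vs + c * wedge (flat u) (wedge (flat v) \<gamma>) vs)"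
proof -
  let ?v = "wedge (flat v) \<gamma>" and ?uv = "wedge (flat u) (wedge (flat v) \<gamma>)"
  let ?N = "frame_inner es \<gamma> \<gamma>"
  have F: "\<gamma> \<in> forms_on UNIV" "?v \<in> forms_on UNIV" "?uv \<in> forms_on UNIV"
    using \<gamma>(1) by (simp_all add: conformal_def forms_wedge forms_flat)
  have cv: "contract v ?v = \<gamma>" and cu: "contract u ?v = (\<lambda>vs. 0)"
    using \<gamma> uv by (simp_all add: contract_wedge_flat inner_commute)
  have cuv: "contract u ?uv = ?v"
    using uv by (simp add: contract_wedge_flat[of u u] cu)
  have "frame_inner es ?uv \<gamma> = 0"
    by (simp add: frame_inner_wedge_flat[OF frame] F \<gamma> frame_inner_linear)
  moreover have "frame_inner es ?uv ?uv = ?N"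
    by (simp add: frame_inner_wedge_flat[OF frame] F cuv cv)
  ultimately have N: "frame_inner es (\<lambda>vs. \<gamma> vs + c * ?uv vs) (\<lambda>vs. \<gamma> vs + c * ?uv vs) = (1 + c\<^sup>2) * ?N"
    by (simp add: frame_inner_linear frame_inner_commute[of es \<gamma> ?uv] power2_eq_square algebra_simps)
  have "q (act es cl (\<lambda>vs. \<gamma> vs + c * ?uv vs) \<Psi>) (act es cl (\<lambda>vs. \<gamma> vs + c * ?uv vs) \<Psi>) =
      of_real ((1 + c\<^sup>2) * ?N) * q \<Psi> \<Psi>" for \<Psi>
  proof -
    define \<Phi> where "\<Phi> = act es cl \<gamma> \<Psi>"
    have a: "act es cl (\<lambda>vs. \<gamma> vs + c * ?uv vs) \<Psi> = \<Phi> + c *\<^sub>R cl u (cl v \<Phi>)"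
      by (simp add: \<Phi>_def act_linear act_wedge_flat F \<gamma> cu)
    have "q (cl u (cl v \<Phi>)) \<Phi> = - q \<Phi> (cl u (cl v \<Phi>))"
      by (simp add: q_cl q_minus cl_orthogonal[of v u] inner_commute uv)
    moreover have "q (cl u (cl v \<Phi>)) (cl u (cl v \<Phi>)) = q \<Phi> \<Phi>"
      by (simp add: q_cl_unit uv)
    ultimately have "q (\<Phi> + c *\<^sub>R cl u (cl v \<Phi>)) (\<Phi> + c *\<^sub>R cl u (cl v \<Phi>)) =
        (1 + (of_real c)\<^sup>2) * q \<Phi> \<Phi>"
      by (simp add: q_add q_left_add q_scaleR power2_eq_square algebra_simps)
    also have "q \<Phi> \<Phi> = of_real ?N * q \<Psi> \<Psi>"
      using \<gamma>(1) by (simp add: \<Phi>_def conformal_def)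
    finally show ?thesis by (simp add: a)
  qed
  moreover have "0 < (1 + c\<^sup>2) * ?N"
    using \<gamma>(1) by (intro mult_pos_pos) (simp_all add: conformal_def add_pos_nonneg)
  ultimately show ?thesis
    by (simp add: conformal_def N forms_add forms_scale F)
qed

text \<open>The induction on \<open>dim L\<close> splits one plane off \<open>C\<close> at a time,
  so no complete normal form has to be stated. The rest of \<open>C\<close> is supported on the
  complement \<open>L'\<close> of the plane in \<open>L\<close>.\<close>

lemma conformal_exp_wedge:
  assumes "subspace L" "C \<in> p_forms_on UNIV 2"
    and "\<And>n. (\<And>l. l \<in> L \<Longrightarrow> n \<bullet> l = 0) \<Longrightarrow> contract n C = (\<lambda>vs. 0)"
    and "conformal \<gamma>" "\<And>l. l \<in> L \<Longrightarrow> contract l \<gamma> = (\<lambda>vs. 0)"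
  shows "conformal (wedge (exp_form C) \<gamma>)"
  using assms
proof (induction "dim L" arbitrary: L C rule: less_induct)
  case less
  note L = less.prems(1) and C = less.prems(2) and normal = less.prems(3) and \<gamma> = less.prems(4,5)
  have F: "C \<in> forms_on UNIV" using C by (rule p_forms_forms)
  \<comment> \<open>As \<open>C\<close> is supported on \<open>L\<close>, its arguments may be
    projected to \<open>L\<close>; formulas known on \<open>L\<close> thus extend to all
    vectors.\<close>
  have CL: "C [x, y] = C [x, orth_proj L y]" and orth_proj_L: "orth_proj L y \<in> L"
    and res: "\<And>l. l \<in> L \<Longrightarrow> (y - orth_proj L y) \<bullet> l = 0" for x y
  proof -
    obtain ls where ls: "orthonormal_basis L ls" using ex_orthonormal_basis[OF L] .
    then have L': "L = span (set ls)" "orthonormal_list ls" by (auto simp: orthonormal_basis_iff)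
    show r: "(y - orth_proj L y) \<bullet> l = 0" if "l \<in> L" for l
      unfolding orth_proj_eq[OF ls] using that L' by (simp add: frame_proj_residue)
    show "orth_proj L y \<in> L"
      unfolding orth_proj_eq[OF ls] using L' by (simp add: frame_proj_in_span)
    have "contract (y - orth_proj L y) C = (\<lambda>vs. 0)"
      by (rule normal) (rule r)
    then have "contract y C = contract (orth_proj L y) C"
      by (simp add: contract_linear F fun_eq_iff)
    then have "C [y, x] = C [orth_proj L y, x]"
      by (simp add: contract_def fun_eq_iff)
    moreover have "C [a, b] = - C [b, a]" for a b
      using fun_cong[OF contract_swap[OF F, of b a], of "[]"] by (simp add: contract_def)
    ultimately show "C [x, y] = C [x, orth_proj L y]" by metis
  qed
  have contract_eq: "contract u C = (\<lambda>vs. c * flat a vs)"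
    if "a \<in> L" "\<And>x. x \<in> L \<Longrightarrow> C [u, x] = c * (a \<bullet> x)" for u a c
  proof
    fix vs
    show "contract u C vs = c * flat a vs"
    proof (cases "length vs = 1")
      case True
      then obtain y where y: "vs = [y]" by (auto simp: length_Suc_conv)
      have "a \<bullet> y = a \<bullet> orth_proj L y"
        using res[OF that(1), of y] by (simp add: inner_diff_left inner_commute[of a])
      then show ?thesis
        using CL[of u y] that(2)[OF orth_proj_L, of y] by (simp add: y contract_def flat_def)
    next
      case False
      then show ?thesis using C by (simp add: p_forms_UNIV_iff contract_def flat_def)
    qed
  qed
  show ?case
  proof (cases "\<exists>x\<in>L. \<exists>y\<in>L. C [x, y] \<noteq> 0")
    case False
    have "contract l C = (\<lambda>vs. 0)" if "l \<in> L" for l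
      using contract_eq[of 0 l 0] False that L by (simp add: subspace_0)
    then have "contract x C = (\<lambda>vs. 0)" for x
      using normal[of "x - orth_proj L x"] res[of _ x] orth_proj_L[of x]
      by (simp add: contract_linear F fun_eq_iff)
    moreover have "C [] = 0"
      using C unfolding p_forms_UNIV_iff by simp
    ultimately have "C = (\<lambda>vs. 0)"
      by - (rule form_ext, simp_all)
    then show ?thesis using \<gamma>(1) by (simp add: exp_form_zero)
  next
    case True
    then obtain u v c where uvL: "u \<in> L" "v \<in> L" and unit: "u \<bullet> u = 1" "v \<bullet> v = 1" "u \<bullet> v = 0"
      and Cu: "\<And>x. x \<in> L \<Longrightarrow> C [u, x] = c * (v \<bullet> x)" and Cv: "\<And>x. x \<in> L \<Longrightarrow> C [v, x] = - c * (u \<bullet> x)"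
      using two_form_block[OF C L] by metis
    let ?P = "wedge (flat u) (flat v)"
    define C' where "C' = (\<lambda>vs. C vs - c * ?P vs)"
    define L' where "L' = {x \<in> L. u \<bullet> x = 0 \<and> v \<bullet> x = 0}"
    have C': "C' \<in> p_forms_on UNIV 2"
      unfolding C'_def by (intro p_forms_diff C p_forms_scale p_forms_flat_flat)
    have F': "C' \<in> forms_on UNIV" using C' by (rule p_forms_forms)
    have sL': "subspace L'"
      using L by (auto simp: L'_def subspace_def inner_add_right)
    have "u \<notin> L'" "L' \<subseteq> L" using unit by (auto simp: L'_def)
    then have "L' \<subset> L" using uvL(1) by blast
    then have "dim L' < dim L"
      using L sL' by (metis dim_psubset span_eq_iff)
    have cP: "contract w ?P = (\<lambda>vs. (u \<bullet> w) * flat v vs - (v \<bullet> w) * flat u vs)" for w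
      by (simp add: contract_wedge_flat wedge_linear)
    have u0: "contract u C' = (\<lambda>vs. 0)"
      using contract_eq[OF uvL(2) Cu] unit by (simp add: C'_def cP inner_commute)
    have v0: "contract v C' = (\<lambda>vs. 0)"
      using contract_eq[OF uvL(1) Cv] unit by (simp add: C'_def cP inner_commute)
    \<comment> \<open>A vector orthogonal to \<open>L'\<close> is a combination of \<open>u\<close>
      and \<open>v\<close> plus a vector \<open>n'\<close> orthogonal to all of
      \<open>L\<close>.\<close>
    have n0: "contract n C' = (\<lambda>vs. 0)" if n: "\<And>l. l \<in> L' \<Longrightarrow> n \<bullet> l = 0" for n
    proof -
      define n' where "n' = n - (n \<bullet> u) *\<^sub>R u - (n \<bullet> v) *\<^sub>R v"
      have n'uv: "n' \<bullet> u = 0" "n' \<bullet> v = 0"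
        using unit by (simp_all add: n'_def inner_diff_left inner_commute[of v u])
      have "n' \<bullet> l = 0" if "l \<in> L" for l
      proof -
        let ?l = "l - (l \<bullet> u) *\<^sub>R u - (l \<bullet> v) *\<^sub>R v"
        have "?l \<in> L'"
          using that uvL unit L
          by (auto simp: L'_def inner_diff_right inner_commute[of v u] inner_commute[of _ l]
              intro!: subspace_diff subspace_scale)
        then have "n \<bullet> ?l = 0" by (rule n)
        then have "n' \<bullet> ?l = 0"
          using \<open>?l \<in> L'\<close> by (simp add: n'_def inner_diff_left L'_def)
        then show ?thesis using n'uv by (simp add: inner_diff_right)
      qed
      then have "contract n' C = (\<lambda>vs. 0)" by (rule normal)
      then have "contract n' C' = (\<lambda>vs. 0)"
        using n'uv by (simp add: C'_def cP inner_commute)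
      then show ?thesis
        by (simp add: n'_def contract_linear F' u0 v0)
    qed
    let ?\<gamma>' = "wedge (exp_form C') \<gamma>"
    have conf: "conformal ?\<gamma>'"
      using \<open>dim L' < dim L\<close> sL' C' n0 \<gamma>(1)
      by (rule less.hyps) (use \<gamma>(2) in \<open>auto simp: L'_def\<close>)
    have "contract u ?\<gamma>' = (\<lambda>vs. 0)" "contract v ?\<gamma>' = (\<lambda>vs. 0)"
      by (simp_all add: contract_wedge contract_exp_form C' u0 v0 \<gamma>(2) uvL)
    then have "conformal (\<lambda>vs. ?\<gamma>' vs + c * wedge (flat u) (wedge (flat v) ?\<gamma>') vs)"
      using conf unit by (intro conformal_pair)
    also have "(\<lambda>vs. ?\<gamma>' vs + c * wedge (flat u) (wedge (flat v) ?\<gamma>') vs) =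
        wedge (exp_form (\<lambda>vs. c * ?P vs)) ?\<gamma>'"
      by (simp add: exp_form_simple fun_eq_iff wedge_linear wedge_assoc)
    also have "\<dots> = wedge (exp_form (\<lambda>vs. c * ?P vs + C' vs)) \<gamma>"
      by (subst exp_form_add[symmetric]) (simp_all add: p_forms_scale p_forms_flat_flat C' wedge_assoc)
    also have "(\<lambda>vs. c * ?P vs + C' vs) = C"
      by (simp add: C'_def fun_eq_iff)
    finally show ?thesis .
  qed
qed

end

section \<open>Charge conjugation is an isometry\<close>

lemma orthonormal_list_nth:
  assumes "orthonormal_list vs" "i < length vs" "j < length vs"
  shows "vs ! i \<bullet> vs ! j = of_bool (i = j)"
  using orthonormal_listD[OF assms(1)] assms(2,3) by (auto simp: nth_eq_iff_index_eq)

context spin_representation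
begin

text \<open>The commuting involutions \<open>i e\<^sub>2\<^sub>j e\<^sub>2\<^sub>j\<^sub>+\<^sub>1\<close>, indexed from \<open>j = 0\<close>, have one-dimensional joint
  eigenspaces, which the vectors \<open>e\<^sub>2\<^sub>j\<close> permute transitively. This replaces Schur's lemma.\<close>

definition plane_invol :: "nat \<Rightarrow> complex ^ 'd \<Rightarrow> complex ^ 'd" where
  "plane_invol j \<Psi> = \<i> *s cl (es ! (2 * j)) (cl (es ! Suc (2 * j)) \<Psi>)"

definition joint_eigenspinor :: "nat \<Rightarrow> complex ^ 'd \<Rightarrow> bool" where
  "joint_eigenspinor k \<Psi> \<longleftrightarrow> (\<forall>j<k. \<exists>s\<in>{1, -1}. plane_invol j \<Psi> = s *s \<Psi>)"

lemma joint_eigenspinorD: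
  "joint_eigenspinor k \<psi> \<Longrightarrow> j < k \<Longrightarrow> \<exists>s. s \<in> {1, -1} \<and> plane_invol j \<psi> = s *s \<psi>"
  unfolding joint_eigenspinor_def by blast

lemma length_es: "length es = DIM('a)"
  using orthonormal_basis_length[OF frame] by simp

lemma es_inner: "i < DIM('a) \<Longrightarrow> j < DIM('a) \<Longrightarrow> es ! i \<bullet> es ! j = of_bool (i = j)"
  using orthonormal_list_nth[OF orthonormal_frame] by (simp add: length_es)

lemma es_cl_swap:
  "i < DIM('a) \<Longrightarrow> j < DIM('a) \<Longrightarrow> i \<noteq> j \<Longrightarrow> cl (es ! i) (cl (es ! j) \<Psi>) = - cl (es ! j) (cl (es ! i) \<Psi>)"
  by (rule cl_orthogonal) (simp add: es_inner)

lemma es_cl_square: "i < DIM('a) \<Longrightarrow> cl (es ! i) (cl (es ! i) \<Psi>) = - \<Psi>"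
  by (rule cl_unit) (simp add: es_inner)

lemma plane_invol_cl_same:
  assumes "2 * j + 1 < DIM('a)"
  shows "plane_invol j (cl (es ! (2 * j)) \<Psi>) = - cl (es ! (2 * j)) (plane_invol j \<Psi>)"
  using assms
  by (simp add: plane_invol_def es_cl_swap[of "Suc (2 * j)" "2 * j"] cl_spinor_simps cl_scale)

lemma plane_invol_cl_other:
  assumes "2 * j + 1 < DIM('a)" "i < DIM('a)" "i \<noteq> 2 * j" "i \<noteq> Suc (2 * j)"
  shows "plane_invol j (cl (es ! i) \<Psi>) = cl (es ! i) (plane_invol j \<Psi>)"
  using assms
  by (simp add: plane_invol_def es_cl_swap[of _ i] cl_spinor_simps cl_scale)

lemma plane_invol_scale: "plane_invol j (c *s \<Psi>) = c *s plane_invol j \<Psi>"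
  by (simp add: plane_invol_def cl_scale vector_smult_assoc mult.commute)

lemma plane_invol_add: "plane_invol j (\<Psi> + \<Phi>) = plane_invol j \<Psi> + plane_invol j \<Phi>"
  by (simp add: plane_invol_def cl_add vector_add_ldistrib)

lemma plane_invol_invol:
  assumes "2 * j + 1 < DIM('a)"
  shows "plane_invol j (plane_invol j \<Psi>) = \<Psi>"
  using assms
  by (simp add: plane_invol_def cl_scale es_cl_swap[of "Suc (2 * j)" "2 * j"] es_cl_square
      cl_spinor_simps vector_smult_assoc)

lemma plane_invol_commute:
  assumes "2 * j + 1 < DIM('a)" "2 * k + 1 < DIM('a)" "j \<noteq> k"
  shows "plane_invol j (plane_invol k \<Psi>) = plane_invol k (plane_invol j \<Psi>)"
proof -
  have "2 * k \<noteq> 2 * j" "2 * k \<noteq> Suc (2 * j)" "Suc (2 * k) \<noteq> 2 * j" "Suc (2 * k) \<noteq> Suc (2 * j)"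
    using assms(3) by presburger+
  then show ?thesis
    using assms by (simp add: plane_invol_def[of k] plane_invol_scale plane_invol_cl_other)
qed

lemma plane_invol_q:
  assumes "2 * j + 1 < DIM('a)"
  shows "q (plane_invol j \<Psi>) \<Phi> = q \<Psi> (plane_invol j \<Phi>)"
  using assms
  by (simp add: plane_invol_def q_left_scale q_scale q_cl es_cl_swap[of "Suc (2 * j)" "2 * j"] q_minus)

text \<open>\<open>\<psi> + plane_invol k \<psi>\<close> has eigenvalue 1 for the new involution and
  keeps the old eigenvalues; if it vanishes, \<open>\<psi>\<close> itself has eigenvalue -1.\<close>

lemma ex_joint_eigenspinor:
  assumes "2 * k \<le> DIM('a)"
  shows "\<exists>\<psi>. \<psi> \<noteq> 0 \<and> joint_eigenspinor k \<psi>"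
  using assms
proof (induction k)
  case 0
  have "(1 :: complex ^ 'd) \<noteq> 0" by simp
  then show ?case by (auto simp: joint_eigenspinor_def)
next
  case (Suc k)
  then obtain \<psi> where \<psi>: "\<psi> \<noteq> 0" "joint_eigenspinor k \<psi>" by auto
  let ?\<phi> = "\<psi> + plane_invol k \<psi>"
  show ?case
  proof (cases "?\<phi> = 0")
    case True
    then have "plane_invol k \<psi> = (-1) *s \<psi>"
      by (simp add: eq_neg_iff_add_eq_0 add.commute)
    then show ?thesis
      using \<psi> by (auto simp: joint_eigenspinor_def less_Suc_eq)
  next
    case False
    have "plane_invol k ?\<phi> = 1 *s ?\<phi>"
      using Suc.prems by (simp add: plane_invol_add plane_invol_invol add.commute)
    moreover have "\<exists>s\<in>{1, -1}. plane_invol j ?\<phi> = s *s ?\<phi>" if j: "j < k" for j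
    proof -
      obtain s where "s \<in> {1, -1}" "plane_invol j \<psi> = s *s \<psi>"
        using joint_eigenspinorD[OF \<psi>(2) j] by blast
      moreover have "plane_invol j (plane_invol k \<psi>) = plane_invol k (plane_invol j \<psi>)"
        using j Suc.prems by (intro plane_invol_commute) auto
      ultimately have "plane_invol j ?\<phi> = s *s ?\<phi>"
        by (simp add: plane_invol_add plane_invol_scale vector_add_ldistrib)
      then show ?thesis using \<open>s \<in> {1, -1}\<close> by blast
    qed
    ultimately have "joint_eigenspinor (Suc k) ?\<phi>"
      unfolding joint_eigenspinor_def by (metis insertI1 less_antisym)
    then show ?thesis using False by blast
  qed
qed

text \<open>One vector from each plane; the number of subsets equals the spinor dimension.\<close>

definition even_vectors :: "'a set" where
  "even_vectors = (\<lambda>j. es ! (2 * j)) ` {..<(DIM('a) div 2)}"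

lemma even_index_inj: "i < (DIM('a) div 2) \<Longrightarrow> j < (DIM('a) div 2) \<Longrightarrow> es ! (2 * i) = es ! (2 * j) \<longleftrightarrow> i = j"
  using orthonormal_listD(1)[OF orthonormal_frame] by (simp add: nth_eq_iff_index_eq length_es)

lemma card_even_vectors: "card even_vectors = (DIM('a) div 2)"
  unfolding even_vectors_def by (subst card_image) (auto simp: inj_on_def even_index_inj)

lemma even_vectors_unit: "v \<in> even_vectors \<Longrightarrow> v \<bullet> v = 1"
  by (auto simp: even_vectors_def es_inner)

text \<open>Each vector of the word flips only the eigenvalue of its own plane, so the eigenvalues
  record which vectors occur.\<close>

lemma plane_invol_foldr:
  assumes "distinct us" "set us \<subseteq> even_vectors" "j < (DIM('a) div 2)" "plane_invol j \<psi> = s *s \<psi>"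
  shows "plane_invol j (foldr cl us \<psi>) =
    ((if es ! (2 * j) \<in> set us then -1 else 1) * s) *s foldr cl us \<psi>"
  using assms
proof (induction us)
  case (Cons u us)
  then obtain i where i: "i < (DIM('a) div 2)" "u = es ! (2 * i)" by (auto simp: even_vectors_def)
  show ?case
  proof (cases "i = j")
    case True
    then show ?thesis
      using Cons i by (auto simp: plane_invol_cl_same cl_scale)
  next
    case False
    then have "2 * i \<noteq> 2 * j" "2 * i \<noteq> Suc (2 * j)" by presburger+
    then show ?thesis
      using Cons i False by (auto simp: plane_invol_cl_other cl_scale even_index_inj cl_spinor_simps)
  qed
qed simp

lemma foldr_cl_orthogonal:
  assumes us: "distinct us" "set us \<subseteq> even_vectors" and vs: "distinct vs" "set vs \<subseteq> even_vectors"
    and ne: "set us \<noteq> set vs" and \<psi>: "joint_eigenspinor (DIM('a) div 2) \<psi>"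
  shows "q (foldr cl us \<psi>) (foldr cl vs \<psi>) = 0"
proof -
  obtain v where v: "v \<in> even_vectors" "v \<in> set us \<longleftrightarrow> v \<notin> set vs"
    using us vs ne by blast
  then obtain j where j: "j < (DIM('a) div 2)" "v = es ! (2 * j)" by (auto simp: even_vectors_def)
  obtain s where s: "s \<in> {1, -1}" "plane_invol j \<psi> = s *s \<psi>"
    using joint_eigenspinorD[OF \<psi> j(1)] by blast
  have "2 * j + 1 < DIM('a)" using j by linarith
  from plane_invol_q[OF this, of "foldr cl us \<psi>" "foldr cl vs \<psi>"] show ?thesis
    using v j s
    by (auto simp: plane_invol_foldr[OF us _ s(2)] plane_invol_foldr[OF vs _ s(2)] q_left_scale q_scale)
qed

text \<open>One ordering is fixed for each set, so that spinors can be indexed by subsets; for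
  subsets of \<open>even_vectors\<close> another ordering changes \<open>foldr cl\<close> only by a
  sign.\<close>

definition word :: "'a set \<Rightarrow> 'a list" where
  "word U = (SOME us. distinct us \<and> set us = U)"

lemma word: "U \<subseteq> even_vectors \<Longrightarrow> distinct (word U) \<and> set (word U) = U"
  unfolding word_def
  by (rule someI_ex) (metis even_vectors_def finite_distinct_list finite_imageI finite_lessThan finite_subset)

lemma q_word:
  assumes "U \<subseteq> even_vectors" "V \<subseteq> even_vectors" "joint_eigenspinor (DIM('a) div 2) \<psi>"
  shows "q (foldr cl (word U) \<psi>) (foldr cl (word V) \<psi>) = of_bool (U = V) * q \<psi> \<psi>"
proof (cases "U = V")
  case True
  then show ?thesis
    using word[OF assms(2)] assms(2) by (auto intro!: q_foldr_cl even_vectors_unit)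
next
  case False
  then show ?thesis
    using foldr_cl_orthogonal[of "word U" "word V" \<psi>] word[OF assms(1)] word[OF assms(2)] assms
    by simp
qed

lemma q_self_nonzero: "\<psi> \<noteq> 0 \<Longrightarrow> q \<psi> \<psi> \<noteq> 0"
  using q_pos[of \<psi>] by auto

text \<open>Nonzero pairwise orthogonal spinors are independent, and there are as many of them as
  the dimension.\<close>

lemma word_spinors_span:
  assumes "\<psi> \<noteq> 0" "joint_eigenspinor (DIM('a) div 2) \<psi>"
  shows "vec.span ((\<lambda>U. foldr cl (word U) \<psi>) ` Pow even_vectors) = UNIV"
proof -
  let ?f = "\<lambda>U. foldr cl (word U) \<psi>" and ?P = "Pow even_vectors"
  have fin: "finite even_vectors" by (simp add: even_vectors_def)
  have o: "q (?f U) (?f V) = of_bool (U = V) * q \<psi> \<psi>" if "U \<in> ?P" "V \<in> ?P" for U V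
    using that assms(2) by (simp add: q_word)
  have inj: "inj_on ?f ?P"
  proof (rule inj_onI, rule ccontr)
    fix U V assume UV: "U \<in> ?P" "V \<in> ?P" "?f U = ?f V" "U \<noteq> V"
    then have "q (?f U) (?f U) = 0" using o[of U V] by simp
    then show False using o[of U U] UV(1) q_self_nonzero[OF assms(1)] by simp
  qed
  have "vec.independent (?f ` ?P)"
  proof (rule vec.independent_if_scalars_zero)
    show "finite (?f ` ?P)" using fin by simp
    fix c x assume z: "(\<Sum>y\<in>?f ` ?P. c y *s y) = 0" and "x \<in> ?f ` ?P"
    then obtain U where U: "U \<in> ?P" "x = ?f U" by auto
    have "0 = q (?f U) (\<Sum>V\<in>?P. c (?f V) *s ?f V)"
      using z by (simp add: sum.reindex[OF inj] q_zero)
    also have "\<dots> = (\<Sum>V\<in>?P. c (?f V) * (of_bool (U = V) * q \<psi> \<psi>))"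
      unfolding q_sum q_scale using U by (intro sum.cong refl) (simp only: o)
    also have "\<dots> = c (?f U) * q \<psi> \<psi>"
      using U fin by (simp add: of_bool_def if_distrib[where f = "\<lambda>x. x * _"]
          if_distrib[where f = "\<lambda>x. _ * x"] cong: if_cong)
    finally show "c x = 0" using q_self_nonzero[OF assms(1)] U by simp
  qed
  moreover have "card (?f ` ?P) = 2 ^ (DIM('a) div 2)"
    by (simp add: card_image[OF inj] card_Pow fin card_even_vectors)
  ultimately have "UNIV \<subseteq> vec.span (?f ` ?P)"
    by (intro vec.card_ge_dim_independent) (simp_all only: vec_dim_card spinor_dim subset_UNIV order_refl simp_thms)
  then show ?thesis by auto
qed

lemma A_cl': "A (cl v \<Psi>) = (-1) ^ ((DIM('a) div 2) + 1) *s cl v (A \<Psi>)"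
  by (rule A_cl[OF refl])

lemma A_square': "A (A \<Psi>) = (-1) ^ ((DIM('a) div 2) * ((DIM('a) div 2) + 1) div 2) *s \<Psi>"
  by (rule A_square[OF refl])

text \<open>Two vectors contribute the same Clifford sign, which cancels, while the factor
  \<open>\<i>\<close> is conjugated: \<open>A\<close> anticommutes with each involution and negates
  its eigenvalue.\<close>

lemma joint_eigenspinor_A:
  assumes "joint_eigenspinor k \<psi>"
  shows "joint_eigenspinor k (A \<psi>)"
proof -
  have An: "A (plane_invol j \<psi>) = (-1) *s plane_invol j (A \<psi>)" for j
  proof -
    define \<sigma> :: complex where "\<sigma> = (-1) ^ (DIM('a) div 2 + 1)"
    have "\<sigma> * \<sigma> = 1" unfolding \<sigma>_def by (simp flip: power_mult_distrib)
    then show ?thesis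
      by (simp add: plane_invol_def A_scale A_cl'[folded \<sigma>_def] cl_scale vector_smult_assoc mult.assoc)
  qed
  have e: "plane_invol j (A \<psi>) = (- cnj s) *s A \<psi>" if s: "plane_invol j \<psi> = s *s \<psi>" for j s
  proof -
    have "cnj s *s A \<psi> = - plane_invol j (A \<psi>)"
      using An[of j] unfolding s A_scale by simp
    then show ?thesis by simp
  qed
  show ?thesis
    unfolding joint_eigenspinor_def
  proof (intro allI impI)
    fix j assume "j < k"
    then obtain s where "s \<in> {1, -1}" "plane_invol j \<psi> = s *s \<psi>"
      using joint_eigenspinorD[OF assms] by blast
    then show "\<exists>s\<in>{1, -1}. plane_invol j (A \<psi>) = s *s A \<psi>"
      using e[of j s] by (intro bexI[of _ "- cnj s"]) auto
  qed
qed

lemma A_foldr: "A (foldr cl us \<psi>) = ((-1) ^ ((DIM('a) div 2) + 1)) ^ length us *s foldr cl us (A \<psi>)"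
  by (induction us) (simp_all add: A_cl' cl_scale vector_smult_assoc del: power_Suc2 power_Suc,
      simp add: mult.commute)

text \<open>\<open>A\<close> maps words over \<open>\<psi>\<close> to signed words over
  \<open>A \<psi>\<close>, again a joint eigenspinor. Thus \<open>q\<close> is preserved up to the
  ratio of \<open>q (A \<psi>) (A \<psi>)\<close> to \<open>q \<psi> \<psi>\<close>, and
  \<open>A_square\<close> fixes this ratio.\<close>

lemma q_A:
  shows "q (A \<Psi>) (A \<Psi>) = q \<Psi> \<Psi>"
proof -
  obtain \<psi> where \<psi>: "\<psi> \<noteq> 0" "joint_eigenspinor (DIM('a) div 2) \<psi>"
    using ex_joint_eigenspinor[of "DIM('a) div 2"] by auto
  let ?f = "\<lambda>U. foldr cl (word U) \<psi>" and ?P = "Pow even_vectors"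
  \<comment> \<open>The arguments are swapped on the left because \<open>A\<close> is
    conjugate-linear: both sides are then conjugate-linear in \<open>x\<close> and linear in
    \<open>y\<close>.\<close>
  let ?D = "\<lambda>x y. q (A y) (A x) * q \<psi> \<psi> = q x y * q (A \<psi>) (A \<psi>)"
  have base: "?D (?f U) (?f V)" if "U \<in> ?P" "V \<in> ?P" for U V
  proof -
    have "q (A (?f V)) (A (?f U)) = of_bool (U = V) * q (A \<psi>) (A \<psi>)"
    proof (cases "U = V")
      case True
      then show ?thesis
        using that q_word[of V U "A \<psi>"] joint_eigenspinor_A[OF \<psi>(2)]
        by (simp add: A_foldr q_left_scale q_scale) (simp flip: power_mult_distrib mult.assoc)
    next
      case False
      then show ?thesis
        using that q_word[of V U "A \<psi>"] joint_eigenspinor_A[OF \<psi>(2)]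
        by (simp add: A_foldr q_left_scale q_scale)
    qed
    then show ?thesis using that \<psi>(2) by (simp add: q_word)
  qed
  have A0: "A 0 = 0" using A_scale[of 0 0] by simp
  have 1: "?D x (?f V)" if "V \<in> ?P" for x V
  proof -
    have "x \<in> vec.span (?f ` ?P)" using word_spinors_span[OF \<psi>] by simp
    then show ?thesis
    proof (induction rule: vec.span_induct)
      case base
      show ?case
        by (auto simp: vec.subspace_def A0 q_zero A_add q_add q_left_add A_scale q_scale q_left_scale
            distrib_right)
    qed (use base that in auto)
  qed
  have D: "?D x y" for x y
  proof -
    have "y \<in> vec.span (?f ` ?P)" using word_spinors_span[OF \<psi>] by simp
    then show ?thesis
    proof (induction rule: vec.span_induct)
      case base
      show ?case
        by (auto simp: vec.subspace_def A0 q_zero A_add q_add q_left_add A_scale q_scale q_left_scale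
            distrib_right)
    qed (use 1 in auto)
  qed
  let ?s = "(-1) ^ ((DIM('a) div 2) * ((DIM('a) div 2) + 1) div 2) :: complex"
  have "cnj ?s * ?s = 1"
    by (simp flip: power_mult_distrib)
  then have AA: "q (A (A \<psi>)) (A (A \<psi>)) = q \<psi> \<psi>"
    by (simp add: A_square' q_left_scale q_scale flip: mult.assoc)
  define a where "a = Re (q \<psi> \<psi>)"
  define b where "b = Re (q (A \<psi>) (A \<psi>))"
  have ab: "q \<psi> \<psi> = of_real a" "q (A \<psi>) (A \<psi>) = of_real b"
    unfolding a_def b_def by (rule q_self)+
  have "A \<psi> \<noteq> 0"
    using AA q_self_nonzero[OF \<psi>(1)] by (auto simp: A0 q_zero)
  then have pos: "a > 0" "b > 0"
    using q_pos \<psi>(1) by (simp_all add: a_def b_def)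
  \<comment> \<open>Taking \<open>x = y = A \<psi>\<close> brings in \<open>A (A \<psi>)\<close>, so
    the ratio of \<open>b\<close> to \<open>a\<close> is its own inverse.\<close>
  have "of_real (a * a) = (of_real (b * b) :: complex)"
    using D[of "A \<psi>" "A \<psi>"] AA by (simp add: ab)
  then have "a * a = b * b" by (simp only: of_real_eq_iff)
  then have "a = b" using pos by (metis less_eq_real_def power2_eq_iff_nonneg power2_eq_square)
  then show ?thesis using D[of \<Psi> \<Psi>] pos by (simp add: ab)
qed

end

section \<open>The calibration bound\<close>

lemma orthonormal_list_nths: "orthonormal_list vs \<Longrightarrow> orthonormal_list (nths vs I)"
proof (induction vs arbitrary: I)
  case (Cons v vs)
  then show ?case
    using set_nths_subset[of vs] by (fastforce simp: nths_Cons)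
qed simp

lemma even_part_eq: "even_part \<alpha> = (\<lambda>vs. (1 / 2) * (\<alpha> vs + involute \<alpha> vs))"
  and odd_part_eq: "odd_part \<alpha> = (\<lambda>vs. (1 / 2) * (\<alpha> vs - involute \<alpha> vs))"
  by (auto simp: even_part_def odd_part_def involute_def fun_eq_iff)

text \<open>Degrees add up to \<open>length vs\<close>, so the parity of \<open>\<gamma>\<close>
  decides which part of \<open>\<alpha>\<close> contributes. This is how the parity of
  \<open>dim L\<close> selects \<open>\<rho>ev\<close> or \<open>\<rho>od\<close>.\<close>

lemma wedge_parity_part:
  assumes "involute \<gamma> = (\<lambda>vs. (-1) ^ r * \<gamma> vs)"
  shows "wedge (even_part \<alpha>) \<gamma> vs = (if even (length vs + r) then wedge \<alpha> \<gamma> vs else 0)"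
    and "wedge (odd_part \<alpha>) \<gamma> vs = (if odd (length vs + r) then wedge \<alpha> \<gamma> vs else 0)"
proof -
  have "(-1) ^ r * wedge (involute \<alpha>) \<gamma> vs = involute (wedge \<alpha> \<gamma>) vs"
    by (simp add: involute_wedge assms wedge_linear)
  then have "wedge (involute \<alpha>) \<gamma> vs = (-1) ^ (length vs + r) * wedge \<alpha> \<gamma> vs"
    by (cases "even r") (simp_all add: involute_def power_add)
  then show "wedge (even_part \<alpha>) \<gamma> vs = (if even (length vs + r) then wedge \<alpha> \<gamma> vs else 0)"
    "wedge (odd_part \<alpha>) \<gamma> vs = (if odd (length vs + r) then wedge \<alpha> \<gamma> vs else 0)"
    unfolding even_part_eq odd_part_eq wedge_linear by (simp_all add: minus_one_power_iff)
qed

lemma hat_p_form: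
  "\<alpha> \<in> p_forms_on UNIV p \<Longrightarrow> hat \<alpha> = (\<lambda>vs. (-1) ^ (p * (p + 1) div 2) * \<alpha> vs)"
  by (auto simp: p_forms_UNIV_iff hat_def fun_eq_iff)

text \<open>As \<open>D\<close> vanishes on pairs from \<open>ls\<close>, every term of its
  expansion contains a normal covector, and the product of all of these annihilates it.\<close>

lemma two_form_wedge_bform:
  assumes fs: "orthonormal_basis UNIV (ls @ ns)" and D: "D \<in> p_forms_on UNIV 2"
    and z: "\<And>x y. x \<in> set ls \<Longrightarrow> y \<in> set ls \<Longrightarrow> D [x, y] = 0"
  shows "wedge D (bform ns) = (\<lambda>vs. 0)"
proof
  fix vs
  let ?fs = "ls @ ns"
  have F: "D \<in> forms_on UNIV" using D by (rule p_forms_forms)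
  have "D (nths ?fs K) * wedge (bform (nths ?fs K)) (bform ns) vs = 0" for K
  proof (cases "set (nths ?fs K) \<subseteq> set ls")
    case True
    have "D (nths ?fs K) = 0"
    proof (cases "length (nths ?fs K) = 2")
      case len: True
      then obtain x y where "nths ?fs K = [x, y]"
        by (auto simp: numeral_2_eq_2 length_Suc_conv)
      then show ?thesis using True z by simp
    next
      case False
      then show ?thesis using D unfolding p_forms_UNIV_iff by blast
    qed
    then show ?thesis by simp
  next
    case False
    then have "\<not> distinct (nths ?fs K @ ns)"
      using set_nths_subset[of ?fs K] by auto
    then have "wedge (bform (nths ?fs K)) (bform ns) = (\<lambda>vs. 0)"
      unfolding bform_append[symmetric] by (rule bform_not_distinct)
    then show ?thesis by simp
  qed
  then have "(\<Sum>K\<in>Pow {..<length ?fs}. D (nths ?fs K) * wedge (bform (nths ?fs K)) (bform ns) vs) = 0"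
    by (intro sum.neutral) blast
  moreover have "D = (\<lambda>vs. \<Sum>K\<in>Pow {..<length ?fs}. D (nths ?fs K) * bform (nths ?fs K) vs)"
    by (rule ext) (rule form_expansion[OF fs F])
  then have "wedge D (bform ns) vs =
      wedge (\<lambda>vs. \<Sum>K\<in>Pow {..<length ?fs}. D (nths ?fs K) * bform (nths ?fs K) vs) (bform ns) vs"
    by (rule arg_cong)
  ultimately show "wedge D (bform ns) vs = 0"
    by (simp only: wedge_sum_left wedge_scale_left)
qed

lemma ex_adapted_basis:
  fixes L :: "'a::euclidean_space set"
  assumes "orthonormal_basis L ls"
  obtains ns where "orthonormal_basis UNIV (ls @ ns)"
proof -
  have L: "L = span (set ls)" "orthonormal_list ls" using assms by (auto simp: orthonormal_basis_iff)
  have "subspace (orthogonal_comp L)" by (rule subspace_orthogonal_comp)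
  then obtain ns where "orthonormal_basis (orthogonal_comp L) ns" by (rule ex_orthonormal_basis)
  then have ns: "orthogonal_comp L = span (set ns)" "orthonormal_list ns"
    by (auto simp: orthonormal_basis_iff)
  have "x \<in> span (set (ls @ ns))" for x
  proof -
    have "x - frame_proj ls x \<in> span (set ns)"
      unfolding ns(1)[symmetric]
      by (auto simp: orthogonal_comp_def orthogonal_def L frame_proj_residue inner_commute[of _ "_ - _"])
    then have "frame_proj ls x + (x - frame_proj ls x) \<in> span (set (ls @ ns))"
      using frame_proj_in_span[of ls x] span_mono[of "set ls" "set (ls @ ns)"]
        span_mono[of "set ns" "set (ls @ ns)"] by (intro span_add) auto
    then show ?thesis by simp
  qed
  moreover have "u \<bullet> v = 0" if "u \<in> set ls" "v \<in> set ns" for u v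
  proof -
    have "v \<in> orthogonal_comp L" using that(2) ns(1) by (simp add: span_base)
    then show ?thesis
      using that(1) by (auto simp: orthogonal_comp_def orthogonal_def L span_base)
  qed
  ultimately have "orthonormal_basis UNIV (ls @ ns)"
    using L ns(2) by (auto simp: orthonormal_basis_iff orthonormal_list_append)
  then show ?thesis by (rule that)
qed

lemma forms_parity_part:
  assumes "\<alpha> \<in> forms_on UNIV" "B \<in> p_forms_on UNIV 2"
  shows "wedge (exp_form B) (even_part \<alpha>) \<in> even_forms"
    and "wedge (exp_form B) (odd_part \<alpha>) \<in> odd_forms"
proof -
  have e: "involute (even_part \<alpha>) = even_part \<alpha>" "involute (odd_part \<alpha>) = (\<lambda>vs. - odd_part \<alpha> vs)"
    by (auto simp: involute_def even_part_def odd_part_def fun_eq_iff)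
  have "involute (wedge (exp_form B) (even_part \<alpha>)) = wedge (exp_form B) (even_part \<alpha>)"
    "involute (wedge (exp_form B) (odd_part \<alpha>)) = (\<lambda>vs. - wedge (exp_form B) (odd_part \<alpha>) vs)"
    by (simp_all add: involute_wedge involute_exp assms e fun_eq_iff wedge_linear)
  then have "(-1) ^ length vs * wedge (exp_form B) (even_part \<alpha>) vs = wedge (exp_form B) (even_part \<alpha>) vs"
    "(-1) ^ length vs * wedge (exp_form B) (odd_part \<alpha>) vs = - wedge (exp_form B) (odd_part \<alpha>) vs" for vs
    unfolding involute_def by metis+
  then have "odd (length vs) \<Longrightarrow> wedge (exp_form B) (even_part \<alpha>) vs = 0"
    "even (length vs) \<Longrightarrow> wedge (exp_form B) (odd_part \<alpha>) vs = 0" for vs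
    by (metis (full_types) equal_neg_zero mult_1 mult_minus1 neg_one_odd_power neg_one_even_power)+
  then show "wedge (exp_form B) (even_part \<alpha>) \<in> even_forms"
    "wedge (exp_form B) (odd_part \<alpha>) \<in> odd_forms"
    unfolding even_forms_def odd_forms_def
    using assms by (simp_all add: forms_wedge forms_exp forms_even_part)
qed

context spin_representation
begin

text \<open>\<open>F\<close> is pulled back from \<open>L\<close> but \<open>B\<close> is not, so
  their difference \<open>C\<close> has mixed and normal parts, gathered in \<open>D\<close>. The
  normal volume form absorbs \<open>exp_form D\<close>, which leaves an exponential supported on
  \<open>L\<close>.\<close>

lemma twisted_tau:
  assumes B: "B \<in> p_forms_on UNIV 2" and pair: "isotropic_pair L \<omega> F"
  defines "\<beta> \<equiv> wedge (exp_form (\<lambda>vs. - B vs)) (tau es L \<omega> F)"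
  shows "conformal \<beta>" and "involute \<beta> = (\<lambda>vs. (-1) ^ (DIM('a) - dim L) * \<beta> vs)"
proof -
  obtain ls where L: "subspace L" and F: "F \<in> p_forms_on L 2" and \<omega>: "\<omega> \<in> p_forms_on L (dim L)"
    and ls: "orthonormal_basis L ls" and \<omega>ls: "\<bar>\<omega> ls\<bar> = 1"
    using pair by (auto simp: isotropic_pair_def is_vol_form_def)
  have lenls: "length ls = dim L" by (rule orthonormal_basis_length[OF ls])
  obtain ns where fs: "orthonormal_basis UNIV (ls @ ns)" using ex_adapted_basis[OF ls] .
  have lenns: "length ns = DIM('a) - dim L"
    using orthonormal_basis_length[OF fs] lenls by simp
  have ol: "orthonormal_list ls" and on: "orthonormal_list ns" and L': "L = span (set ls)"
    and orth: "\<And>u v. u \<in> set ls \<Longrightarrow> v \<in> set ns \<Longrightarrow> u \<bullet> v = 0"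
    using ls fs by (auto simp: orthonormal_basis_iff orthonormal_list_append)
  let ?P = "orth_proj L"
  have P: "?P = frame_proj ls" by (rule orth_proj_eq[OF ls])
  have Plin: "linear ?P" and Prange: "range ?P \<subseteq> L"
    unfolding P by (auto simp: linear_frame_proj L' frame_proj_in_span)
  \<comment> \<open>The constant collects the sign of \<open>hat\<close> in degree
    \<open>length ns\<close>, the orientation of \<open>L\<close> and the determinant from the Hodge
    dual.\<close>
  define c where "c = (-1) ^ (length ns * (length ns + 1) div 2) * (\<omega> ls * bform (ls @ ns) es)"
  have h: "hodge es (pull_back ?P \<omega>) = (\<lambda>vs. \<omega> ls * bform (ls @ ns) es * bform ns vs)"
    by (rule hodge_pull_back[OF frame ls fs]) (simp add: lenls \<omega>)
  have hodge: "hat (hodge es (pull_back ?P \<omega>)) = (\<lambda>vs. c * bform ns vs)"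
    unfolding h c_def by (simp add: hat_p_form[OF p_forms_bform] fun_eq_iff)
  have "c \<noteq> 0"
    using \<omega>ls bform_basis_nonzero[OF frame fs] by (auto simp: c_def)
  let ?F = "pull_back ?P F"
  have F': "?F \<in> p_forms_on UNIV 2" by (rule p_forms_pull_back[OF F Plin Prange])
  define C where "C = (\<lambda>vs. - B vs + ?F vs)"
  have C: "C \<in> p_forms_on UNIV 2"
    unfolding C_def by (intro p_forms_add p_forms_minus B F')
  have \<beta>: "\<beta> = (\<lambda>vs. c * wedge (exp_form C) (bform ns) vs)"
    unfolding \<beta>_def tau_def hodge C_def exp_form_add[OF p_forms_minus[OF B] F', symmetric]
    by (simp add: fun_eq_iff wedge_scale_right flip: wedge_assoc)
  define C' where "C' = pull_back ?P C"
  define D where "D = (\<lambda>vs. C vs - C' vs)"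
  have C': "C' \<in> p_forms_on UNIV 2"
    unfolding C'_def by (rule p_forms_pull_back[OF C Plin]) simp
  have D: "D \<in> p_forms_on UNIV 2"
    unfolding D_def by (intro p_forms_diff C C')
  have Pls: "?P x = x" if "x \<in> set ls" for x
    using that by (simp add: P frame_proj_span ol span_base)
  have D0: "wedge D (bform ns) = (\<lambda>vs. 0)"
    by (rule two_form_wedge_bform[OF fs D]) (simp add: D_def C'_def pull_back_def Pls)
  have "C = (\<lambda>vs. C' vs + D vs)" by (simp add: D_def)
  then have "wedge (exp_form C) (bform ns) = wedge (wedge (exp_form C') (exp_form D)) (bform ns)"
    by (simp only: exp_form_add[OF C' D])
  also have "\<dots> = wedge (exp_form C') (bform ns)"
    by (simp only: wedge_assoc wedge_exp_form_absorb[OF D D0])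
  finally have red: "wedge (exp_form C) (bform ns) = wedge (exp_form C') (bform ns)" .
  have "conformal (wedge (exp_form C') (bform ns))"
  proof (rule conformal_exp_wedge[OF L C'])
    show "contract n C' = (\<lambda>vs. 0)" if "\<And>l. l \<in> L \<Longrightarrow> n \<bullet> l = 0" for n
    proof -
      have "?P n = 0"
        unfolding P using that by (intro frame_proj_orthogonal_eq_0) (simp add: L' span_base)
      then have "contract n C' = contract 0 C'"
        by (simp add: contract_def C'_def pull_back_def linear_0[OF Plin])
      then show ?thesis using p_forms_forms[OF C'] by (simp add: contract_linear)
    qed
    show "conformal (bform ns)" by (rule conformal_bform[OF on])
    show "contract l (bform ns) = (\<lambda>vs. 0)" if "l \<in> L" for l
    proof (rule contract_bform_orthogonal)
      fix n assume n: "n \<in> set ns"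
      have "orthogonal n l"
        using that n by (intro orthogonal_to_span[of l "set ls"])
          (auto simp: L' orthogonal_def orth inner_commute[of n])
      then show "l \<bullet> n = 0" by (simp add: orthogonal_def inner_commute)
    qed
  qed
  then show "conformal \<beta>"
    unfolding \<beta> red using \<open>c \<noteq> 0\<close> by (rule conformal_scale)
  show "involute \<beta> = (\<lambda>vs. (-1) ^ (DIM('a) - dim L) * \<beta> vs)"
    unfolding \<beta> by (simp add: involute_wedge involute_exp[OF C] p_forms_involute[OF p_forms_bform]
        lenns fun_eq_iff wedge_linear)
qed

section \<open>Products with the volume element and the pairing as a spinor product\<close>

lemma foldr_cl_simps:
  "foldr cl us (\<Psi> + \<Phi>) = foldr cl us \<Psi> + foldr cl us \<Phi>"
  "foldr cl us (- \<Psi>) = - foldr cl us \<Psi>"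
  "foldr cl us (r *\<^sub>R \<Psi>) = r *\<^sub>R foldr cl us \<Psi>"
  "foldr cl us 0 = 0"
  by (induction us) (simp_all add: cl_spinor_simps)

lemma foldr_cl_scale: "foldr cl us (c *s \<Psi>) = c *s foldr cl us \<Psi>"
  by (induction us) (simp_all add: cl_scale)

lemma act_scale: "act us cl \<alpha> (c *s \<Psi>) = c *s act us cl \<alpha> \<Psi>"
  by (simp add: act_def foldr_cl_scale scaleR_eq_scale vector_smult_assoc mult.commute
      vec.scale_sum_right)

lemma foldr_cl_orthogonal_vector:
  "(\<And>u. u \<in> set us \<Longrightarrow> u \<bullet> e = 0) \<Longrightarrow>
    foldr cl us (cl e \<Psi>) = (-1) ^ length us *\<^sub>R cl e (foldr cl us \<Psi>)"
  by (induction us) (simp_all add: cl_spinor_simps cl_orthogonal)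

text \<open>Moving \<open>e\<close> to the front passes every vector of the list except itself,
  hence one sign less than for a vector orthogonal to the list.\<close>

lemma foldr_cl_member:
  "orthonormal_list us \<Longrightarrow> e \<in> set us \<Longrightarrow>
    foldr cl us (cl e \<Psi>) = - ((-1) ^ length us *\<^sub>R cl e (foldr cl us \<Psi>))"
proof (induction us)
  case (Cons u us)
  show ?case
  proof (cases "u = e")
    case True
    then have "foldr cl us (cl e \<Psi>) = (-1) ^ length us *\<^sub>R cl e (foldr cl us \<Psi>)"
      using Cons.prems by (intro foldr_cl_orthogonal_vector) (auto simp: inner_commute)
    then show ?thesis using True by (simp add: cl_spinor_simps)
  next
    case False
    then have "u \<bullet> e = 0" using Cons.prems by auto
    then show ?thesis
      using Cons False by (simp add: cl_spinor_simps cl_orthogonal[of u e])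
  qed
qed simp

text \<open>In even dimension the volume element anticommutes with vectors. This is the origin of
  the sign depending on \<open>dim L\<close> in \<open>spinor_condition\<close>.\<close>

lemma volume_act_commute:
  assumes "even DIM('a)"
  shows "foldr cl es (act es cl \<alpha> \<Psi>) = act es cl (involute \<alpha>) (foldr cl es \<Psi>)"
proof -
  have 1: "foldr cl es (cl e \<Psi>) = - cl e (foldr cl es \<Psi>)" if "e \<in> set es" for e \<Psi>
    using foldr_cl_member[OF orthonormal_frame that] assms by (simp add: length_es)
  have 2: "foldr cl es (foldr cl us \<Psi>) = (-1) ^ length us *\<^sub>R foldr cl us (foldr cl es \<Psi>)"
    if "set us \<subseteq> set es" for us
    using that by (induction us) (simp_all add: 1 cl_spinor_simps)
  have s: "foldr cl es (\<Sum>K\<in>S. f K) = (\<Sum>K\<in>S. foldr cl es (f K))" for S and f :: "nat set \<Rightarrow> _"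
    by (induction S rule: infinite_finite_induct) (simp_all add: foldr_cl_simps)
  show ?thesis
    by (simp add: act_def s foldr_cl_simps 2 set_nths_subset involute_def mult.commute)
qed

text \<open>The sign of \<open>hat\<close> is the Clifford square of the complementary product, so
  the shuffle sum rebuilds the full product of \<open>us\<close> in front of the action of
  \<open>\<beta>\<close>. The functional \<open>f\<close> stays general in order to absorb leading
  vectors during the induction.\<close>

lemma wedge_word_functional:
  assumes "linear f" "orthonormal_list us"
  shows "wedge (\<lambda>vs. f (foldr cl vs \<Psi>)) (hat \<beta>) us = f (foldr cl us (act us cl \<beta> \<Psi>))"
  using assms
proof (induction us arbitrary: f \<beta>)
  case Nil
  then show ?case by (simp add: linear_scale)
next
  case (Cons e us)
  let ?\<rho> = "\<lambda>f vs. f (foldr cl vs \<Psi>)" and ?\<beta>' = "contract e \<beta>"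
  have us: "orthonormal_list us" and e: "e \<bullet> e = 1" and o: "\<And>u. u \<in> set us \<Longrightarrow> u \<bullet> e = 0"
    using Cons.prems by (auto simp: inner_commute)
  have fe: "linear (\<lambda>\<Phi>. f (cl e \<Phi>))"
    using linear_compose[OF linear_cl Cons.prems(1), of e] by (simp add: o_def)
  have "wedge (?\<rho> f) (hat \<beta>) (e # us) =
      wedge (?\<rho> (\<lambda>\<Phi>. f (cl e \<Phi>))) (hat \<beta>) us + wedge (involute (?\<rho> f)) (contract e (hat \<beta>)) us"
    by (simp add: wedge_Cons contract_def[of e "?\<rho> f"])
  also have "wedge (involute (?\<rho> f)) (contract e (hat \<beta>)) us =
      - ((-1) ^ length us * wedge (?\<rho> f) (hat ?\<beta>') us)"
    unfolding contract_hat wedge_minus_right involute_wedge[symmetric] by (simp add: involute_def)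
  also have "wedge (?\<rho> f) (hat ?\<beta>') us = f (foldr cl us (act us cl ?\<beta>' \<Psi>))"
    by (rule Cons.IH[OF Cons.prems(1) us])
  also have "wedge (?\<rho> (\<lambda>\<Phi>. f (cl e \<Phi>))) (hat \<beta>) us = f (cl e (foldr cl us (act us cl \<beta> \<Psi>)))"
    by (rule Cons.IH[OF fe us])
  also have "\<dots> + - ((-1) ^ length us * f (foldr cl us (act us cl ?\<beta>' \<Psi>))) =
      f (foldr cl (e # us) (act (e # us) cl \<beta> \<Psi>))"
    by (simp add: act_Cons foldr_cl_simps foldr_cl_orthogonal_vector[OF o] cl_spinor_simps
        cl_unit[OF e] linear_add[OF Cons.prems(1)] linear_diff[OF Cons.prems(1)]
        linear_scale[OF Cons.prems(1)])
  finally show ?case .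
qed

lemma fierz_nths:
  assumes "J \<subseteq> {..<length es}"
  shows "fierz es cl q A \<Psi>L \<Psi>R (nths es J) = q (A \<Psi>L) (foldr cl (nths es J) \<Psi>R)"
proof -
  have "fierz es cl q A \<Psi>L \<Psi>R (nths es J) =
      (\<Sum>K\<in>Pow {..<length es}. if K = J then q (A \<Psi>L) (foldr cl (nths es K) \<Psi>R) else 0)"
    unfolding fierz_def
    by (intro sum.cong refl)
      (auto simp: basis_form_eq bform_nths_nths[OF orthonormal_frame _ assms]
        act_bform[OF orthonormal_list_nths[OF orthonormal_frame]])
  then show ?thesis using assms by simp
qed

lemma forms_re_fierz: "re_form (fierz es cl q A \<Psi>L \<Psi>R) \<in> forms_on UNIV"
proof -
  have "re_form (fierz es cl q A \<Psi>L \<Psi>R) = (\<lambda>vs. \<Sum>K\<in>Pow {..<length es}.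
      Re (q (A \<Psi>L) (act es cl (basis_form es K) \<Psi>R)) * bform (nths es K) vs)"
    by (simp add: re_form_def fierz_def basis_form_eq)
  also have "\<dots> \<in> forms_on UNIV" by (intro forms_sum forms_scale forms_bform)
  finally show ?thesis .
qed

lemma wedge_re_fierz:
  "wedge (re_form (fierz es cl q A \<Psi>L \<Psi>R)) (hat \<beta>) es =
    Re (q (A \<Psi>L) (foldr cl es (act es cl \<beta> \<Psi>R)))"
proof -
  \<comment> \<open>The functional on Clifford words is not alternating on arbitrary lists, but on
    \<open>es\<close> the product sees only sublists of \<open>es\<close>, where it agrees with the
    form.\<close>
  have "wedge (re_form (fierz es cl q A \<Psi>L \<Psi>R)) (hat \<beta>) es =
      wedge (\<lambda>vs. Re (q (A \<Psi>L) (foldr cl vs \<Psi>R))) (hat \<beta>) es"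
    unfolding wedge_def by (intro sum.cong refl) (simp add: re_form_def fierz_nths)
  also have "\<dots> = Re (q (A \<Psi>L) (foldr cl es (act es cl \<beta> \<Psi>R)))"
    by (rule wedge_word_functional[OF _ orthonormal_frame]) (auto intro!: linearI simp: q_add q_scaleR)
  finally show ?thesis .
qed

lemma re_form_parity_part:
  "re_form (even_part \<alpha>) = even_part (re_form \<alpha>)" "re_form (odd_part \<alpha>) = odd_part (re_form \<alpha>)"
  by (auto simp: re_form_def even_part_def odd_part_def)

lemma pairing_exp:
  assumes "B \<in> p_forms_on UNIV 2"
  shows "pairing es (wedge (exp_form B) \<alpha>) \<tau> = wedge \<alpha> (hat (wedge (exp_form (\<lambda>vs. - B vs)) \<tau>)) es"
proof -
  have "wedge (exp_form B) X = wedge X (exp_form B)" for X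
    by (rule wedge_commute_even[OF involute_exp[OF assms]])
  then show ?thesis
    by (simp add: pairing_def hat_wedge hat_exp_form[OF assms] wedge_assoc)
qed

text \<open>The squared length of \<open>\<Phi> - g a\<close> is
  \<open>2 g (g - Re (q a \<Phi>))\<close>: its sign gives the bound, its vanishing the equality
  case.\<close>

lemma unit_spinor_cauchy_schwarz:
  assumes a: "q a a = 1" and \<Phi>: "q \<Phi> \<Phi> = of_real (g\<^sup>2)" and g: "g > 0"
  shows "Re (q a \<Phi>) \<le> g" and "Re (q a \<Phi>) = g \<longleftrightarrow> \<Phi> = g *\<^sub>R a"
proof -
  have "q \<Phi> a = cnj (q a \<Phi>)" by (rule q_hermitian)
  then have e: "Re (q (\<Phi> - g *\<^sub>R a) (\<Phi> - g *\<^sub>R a)) = 2 * g * (g - Re (q a \<Phi>))"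
    by (simp add: q_diff q_scaleR a \<Phi> power2_eq_square algebra_simps)
  have "0 \<le> Re (q \<Psi> \<Psi>)" for \<Psi>
    using q_pos[of \<Psi>] by (cases "\<Psi> = 0") (auto simp: q_zero)
  from this[of "\<Phi> - g *\<^sub>R a"] show "Re (q a \<Phi>) \<le> g"
    unfolding e using g by (simp add: zero_le_mult_iff)
  have "\<Phi> - g *\<^sub>R a = 0" if "Re (q a \<Phi>) = g"
    using q_pos[of "\<Phi> - g *\<^sub>R a"] that unfolding e by auto
  then show "Re (q a \<Phi>) = g \<longleftrightarrow> \<Phi> = g *\<^sub>R a"
    using a by (auto simp: q_scaleR)
qed

text \<open>The volume element is replaced by the scalar through which it acts: on
  \<open>\<Psi>R\<close>, after passing \<open>\<beta>\<close>, for even dimension, and on every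
  spinor for odd dimension.\<close>

lemma spinor_condition_iff:
  assumes g: "gen_norm es B (tau es L \<omega> F) > 0"
    and par: "involute \<beta> = (\<lambda>vs. (-1) ^ (DIM('a) - dim L) * \<beta> vs)"
    and \<beta>: "\<beta> = wedge (exp_form (\<lambda>vs. - B vs)) (tau es L \<omega> F)"
    and chiral: "even DIM('a) \<Longrightarrow> \<exists>s\<in>{1, -1}. \<Psi>R \<in> half_spinors es cl s"
  shows "spinor_condition es cl A B \<Psi>L \<Psi>R L \<omega> F \<longleftrightarrow>
    foldr cl es (act es cl \<beta> \<Psi>R) = gen_norm es B (tau es L \<omega> F) *\<^sub>R A \<Psi>L"
proof -
  let ?g = "gen_norm es B (tau es L \<omega> F)" and ?X = "act es cl \<beta> \<Psi>R"
  have vol: "act es cl (vol_form es) \<Psi> = foldr cl es \<Psi>" for \<Psi>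
    by (simp add: vol_form_eq act_bform orthonormal_frame)
  have unit: "act es cl (unit_tau es B L \<omega> F) \<Psi>R = (1 / ?g) *\<^sub>R ?X"
    using act_linear(4)[of es "1 / ?g" \<beta> \<Psi>R] by (simp add: unit_tau_def \<beta> divide_inverse mult.commute)
  have iff: "A \<Psi>L = c *s ((1 / ?g) *\<^sub>R ?X) \<longleftrightarrow> c *s ?X = ?g *\<^sub>R A \<Psi>L" for c
  proof -
    have e: "c *s ((1 / ?g) *\<^sub>R ?X) = (1 / ?g) *\<^sub>R (c *s ?X)"
      by (simp add: scaleR_eq_scale vector_smult_assoc mult.commute)
    have "y = (1 / ?g) *\<^sub>R x \<longleftrightarrow> x = ?g *\<^sub>R y" for x y :: "complex ^ 'd"
      using g by auto
    then show ?thesis unfolding e .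
  qed
  show ?thesis
  proof (cases "even DIM('a)")
    case True
    then obtain m where m: "DIM('a) = 2 * m" by (elim evenE)
    let ?c = "\<lambda>s. s * (-1) ^ (m * (m + 1) div 2 + dim L) * \<i> ^ m"
    have dL: "dim L \<le> 2 * m" using dim_subset_UNIV[of L] m by simp
    have eq: "foldr cl es ?X = ?c s *s ?X" if "\<Psi>R \<in> half_spinors es cl s" for s
    proof -
      have "foldr cl es \<Psi>R = (s * (-1) ^ (m * (m + 1) div 2) * \<i> ^ m) *s \<Psi>R"
        using that by (simp add: half_spinors_def Let_def m vol)
      moreover have "(-1) ^ (2 * m - dim L) = ((-1) ^ dim L :: real)"
        using dL by (simp add: minus_one_power_iff)
      ultimately have "foldr cl es ?X =
          (-1) ^ dim L *\<^sub>R ((s * (-1) ^ (m * (m + 1) div 2) * \<i> ^ m) *s ?X)"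
        unfolding volume_act_commute[OF True] par by (simp add: act_scale act_linear m)
      then show ?thesis
        by (simp add: scaleR_eq_scale vector_smult_assoc power_add mult_ac)
    qed
    \<comment> \<open>\<open>eq\<close> holds for each sign whose half-spinors contain
      \<open>\<Psi>R\<close>, and chirality provides such a sign.\<close>
    have "spinor_condition es cl A B \<Psi>L \<Psi>R L \<omega> F \<longleftrightarrow>
        (\<forall>s. s \<in> {1, -1} \<and> \<Psi>R \<in> half_spinors es cl s \<longrightarrow> ?c s *s ?X = ?g *\<^sub>R A \<Psi>L)"
      unfolding spinor_condition_def unit iff
      using m by (auto simp del: insert_iff, presburger+)
    also have "\<dots> \<longleftrightarrow> foldr cl es ?X = ?g *\<^sub>R A \<Psi>L"
      using chiral[OF True] eq by metis
    finally show ?thesis .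
  next
    case False
    then obtain m where m: "DIM('a) = 2 * m + 1" by (elim oddE)
    have "foldr cl es ?X = ((-1) ^ (m * (m + 1) div 2) * \<i> ^ (m + 1)) *s ?X"
      using cl_volume[OF m, of ?X] by (simp add: vol)
    moreover have "spinor_condition es cl A B \<Psi>L \<Psi>R L \<omega> F \<longleftrightarrow>
        ((-1) ^ (m * (m + 1) div 2) * \<i> ^ (m + 1)) *s ?X = ?g *\<^sub>R A \<Psi>L"
    proof -
      have "DIM('a) \<noteq> 2 * k" for k using False by auto
      moreover have "DIM('a) = 2 * k + 1 \<longleftrightarrow> k = m" for k using m by auto
      ultimately show ?thesis
        unfolding spinor_condition_def unit iff by simp
    qed
    ultimately show ?thesis by simp
  qed
qed

end

text \<open>The bound alone supplies no pair that attains it: the norms are positive, and for even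
  dimension chirality makes one of \<open>\<rho>ev\<close>, \<open>\<rho>od\<close> vanish. Hence
  each calibration property is equated with the existence of a pair of matching parity that solves
  the spinor equation.\<close>

theorem theorem3p6:
  fixes es :: "'a::euclidean_space list"
    and cl :: "'a \<Rightarrow> complex ^ 'd \<Rightarrow> complex ^ ('d::finite)"
    and q :: "complex ^ 'd \<Rightarrow> complex ^ 'd \<Rightarrow> complex"
    and A :: "complex ^ 'd \<Rightarrow> complex ^ 'd"
    and B \<rho>ev \<rho>od :: "'a list \<Rightarrow> real"
    and \<Psi>L \<Psi>R :: "complex ^ 'd"
  assumes "spin_representation es cl q A"
    and "B \<in> p_forms_on UNIV 2"
    and "q \<Psi>L \<Psi>L = 1" and "q \<Psi>R \<Psi>R = 1"
    and "even DIM('a) \<Longrightarrow> \<exists>s\<in>{1, -1}. \<Psi>L \<in> half_spinors es cl s"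
    and "even DIM('a) \<Longrightarrow> \<exists>s\<in>{1, -1}. \<Psi>R \<in> half_spinors es cl s"
    and "\<rho>ev = wedge (exp_form B) (re_form (even_part (fierz es cl q A \<Psi>L \<Psi>R)))"
    and "\<rho>od = wedge (exp_form B) (re_form (odd_part (fierz es cl q A \<Psi>L \<Psi>R)))"
  shows "(\<forall>\<rho>\<in>{\<rho>ev, \<rho>od}. \<forall>L \<omega> F. isotropic_pair L \<omega> F \<longrightarrow>
            pairing es \<rho> (tau es L \<omega> F) \<le> gen_norm es B (tau es L \<omega> F)) \<and>
         (\<forall>L \<omega> F. isotropic_pair L \<omega> F \<longrightarrow>
            (pairing es (if even (dim L) then \<rho>ev else \<rho>od) (tau es L \<omega> F)
               = gen_norm es B (tau es L \<omega> F)
             \<longleftrightarrow> spinor_condition es cl A B \<Psi>L \<Psi>R L \<omega> F)) \<and>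
         \<rho>ev \<in> even_forms \<and> \<rho>od \<in> odd_forms \<and>
         (gen_calibration es B \<rho>ev \<longleftrightarrow>
            (\<exists>L \<omega> F. isotropic_pair L \<omega> F \<and> even (dim L) \<and>
               spinor_condition es cl A B \<Psi>L \<Psi>R L \<omega> F)) \<and>
         (gen_calibration es B \<rho>od \<longleftrightarrow>
            (\<exists>L \<omega> F. isotropic_pair L \<omega> F \<and> odd (dim L) \<and>
               spinor_condition es cl A B \<Psi>L \<Psi>R L \<omega> F))"
proof -
  interpret spin_representation es cl q A by (rule assms(1))
  note B = assms(2)
  let ?\<beta> = "\<lambda>L \<omega> F. wedge (exp_form (\<lambda>vs. - B vs)) (tau es L \<omega> F)"
  let ?\<Phi> = "\<lambda>L \<omega> F. foldr cl es (act es cl (?\<beta> L \<omega> F) \<Psi>R)"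
  let ?g = "\<lambda>L \<omega> F. gen_norm es B (tau es L \<omega> F)"
  have pos: "0 < ?g L \<omega> F"
    and norm: "q (?\<Phi> L \<omega> F) (?\<Phi> L \<omega> F) = of_real ((?g L \<omega> F)\<^sup>2)"
    and ev: "pairing es \<rho>ev (tau es L \<omega> F) = (if even (dim L) then Re (q (A \<Psi>L) (?\<Phi> L \<omega> F)) else 0)"
    and od: "pairing es \<rho>od (tau es L \<omega> F) = (if odd (dim L) then Re (q (A \<Psi>L) (?\<Phi> L \<omega> F)) else 0)"
    and cond: "spinor_condition es cl A B \<Psi>L \<Psi>R L \<omega> F \<longleftrightarrow> ?\<Phi> L \<omega> F = ?g L \<omega> F *\<^sub>R A \<Psi>L"
    if pair: "isotropic_pair L \<omega> F" for L \<omega> F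
  proof -
    note conf = twisted_tau(1)[OF B pair] and par = twisted_tau(2)[OF B pair]
    have g: "?g L \<omega> F = sqrt (frame_inner es (?\<beta> L \<omega> F) (?\<beta> L \<omega> F))"
      by (simp add: gen_norm_def form_norm_eq)
    show pos: "0 < ?g L \<omega> F" using conf by (simp add: g conformal_def)
    have "q (?\<Phi> L \<omega> F) (?\<Phi> L \<omega> F) = q (act es cl (?\<beta> L \<omega> F) \<Psi>R) (act es cl (?\<beta> L \<omega> F) \<Psi>R)"
      using orthonormal_listD(2)[OF orthonormal_frame] by (rule q_foldr_cl)
    then show "q (?\<Phi> L \<omega> F) (?\<Phi> L \<omega> F) = of_real ((?g L \<omega> F)\<^sup>2)"
      using conf assms(4) by (simp add: g conformal_def)
    have parhat: "involute (hat (?\<beta> L \<omega> F)) = (\<lambda>vs. (-1) ^ (DIM('a) - dim L) * hat (?\<beta> L \<omega> F) vs)"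
      by (simp add: par flip: hat_involute)
    have "dim L \<le> DIM('a)" by (rule dim_subset_UNIV)
    then have "even (length es + (DIM('a) - dim L)) \<longleftrightarrow> even (dim L)"
      unfolding length_es by simp
    then show "pairing es \<rho>ev (tau es L \<omega> F) = (if even (dim L) then Re (q (A \<Psi>L) (?\<Phi> L \<omega> F)) else 0)"
      "pairing es \<rho>od (tau es L \<omega> F) = (if odd (dim L) then Re (q (A \<Psi>L) (?\<Phi> L \<omega> F)) else 0)"
      unfolding assms(7,8) pairing_exp[OF B] re_form_parity_part wedge_parity_part[OF parhat]
        wedge_re_fierz by simp_all
    show "spinor_condition es cl A B \<Psi>L \<Psi>R L \<omega> F \<longleftrightarrow> ?\<Phi> L \<omega> F = ?g L \<omega> F *\<^sub>R A \<Psi>L"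
      using pos par refl assms(6) by (rule spinor_condition_iff)
  qed
  have AL: "q (A \<Psi>L) (A \<Psi>L) = 1" using assms(3) by (simp add: q_A)
  note cs = unit_spinor_cauchy_schwarz[OF AL norm pos]
  \<comment> \<open>In the parity that does not match, the pairing is 0 and lies below the positive
    norm.\<close>
  have bound: "pairing es \<rho> (tau es L \<omega> F) \<le> ?g L \<omega> F"
    if "\<rho> \<in> {\<rho>ev, \<rho>od}" "isotropic_pair L \<omega> F" for \<rho> L \<omega> F
    using that(1) ev[OF that(2)] od[OF that(2)] cs(1)[OF that(2) that(2)] pos[OF that(2)] by auto
  \<comment> \<open>Positivity of the norm excludes equality in the other parity, so equality
    implies the condition on \<open>dim L\<close>.\<close>
  have eq_ev: "pairing es \<rho>ev (tau es L \<omega> F) = ?g L \<omega> F \<longleftrightarrow>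
      even (dim L) \<and> spinor_condition es cl A B \<Psi>L \<Psi>R L \<omega> F"
    and eq_od: "pairing es \<rho>od (tau es L \<omega> F) = ?g L \<omega> F \<longleftrightarrow>
      odd (dim L) \<and> spinor_condition es cl A B \<Psi>L \<Psi>R L \<omega> F"
    if pair: "isotropic_pair L \<omega> F" for L \<omega> F
    unfolding ev[OF pair] od[OF pair] cond[OF pair] cs(2)[OF pair pair, symmetric]
    using pos[OF pair] by auto
  have parity: "\<rho>ev \<in> even_forms" "\<rho>od \<in> odd_forms"
    unfolding assms(7,8) re_form_parity_part by (rule forms_parity_part[OF forms_re_fierz B])+
  have "gen_calibration es B \<rho>ev \<longleftrightarrow>
      (\<exists>L \<omega> F. isotropic_pair L \<omega> F \<and> even (dim L) \<and> spinor_condition es cl A B \<Psi>L \<Psi>R L \<omega> F)"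
    unfolding gen_calibration_def using parity(1) bound[of \<rho>ev] eq_ev by blast
  moreover have "gen_calibration es B \<rho>od \<longleftrightarrow>
      (\<exists>L \<omega> F. isotropic_pair L \<omega> F \<and> odd (dim L) \<and> spinor_condition es cl A B \<Psi>L \<Psi>R L \<omega> F)"
    unfolding gen_calibration_def using parity(2) bound[of \<rho>od] eq_od by blast
  moreover have "pairing es (if even (dim L) then \<rho>ev else \<rho>od) (tau es L \<omega> F) = ?g L \<omega> F \<longleftrightarrow>
      spinor_condition es cl A B \<Psi>L \<Psi>R L \<omega> F" if "isotropic_pair L \<omega> F" for L \<omega> F
    using eq_ev[OF that] eq_od[OF that] by simp
  ultimately show ?thesis
    using bound parity by blast
qed

end
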